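(* Any diffeological bundle with fibrant fiber is a fibration: if $f:X\to Y$ is a diffeological bundle of fiber type $F$ and $F$ is a fibrant diffeological space, then $f$ is a fibration of diffeological spaces.
   Context: A diffeological space is a set $X$ together with, for each $n\in\mathbb{N}$ and each open $U\subseteq\mathbb{R}^n$, a specified set of functions $U\to X$ called plots, such that: every constant map is a plot; if $U\to X$ is a plot and $V\to U$ is a smooth map between open subsets of Euclidean spaces then the composite $V\to X$ is a plot; and a function $U\to X$ whose restriction to each member of some open cover of $U$ is a plot is itself a plot. A map $f:X\to Y$ is smooth if $f\circ p$ is a plot of $Y$ for every plot $p$ of $X$; $C^\infty(X,Y)$ is the set of smooth maps; a diffeomorphism is an isomorphism in the resulting category. Products have plots with both components plots. A subset $A\subseteq X$ has the sub-diffeology: $U\to A$ is a plot iff $U\to A\hookrightarrow X$ is. Smooth manifolds have the usual smooth maps as plots. The $D$-topology on $X$ is the final topology induced by its plots. A smooth map $f:X\to Y$ is trivial of fiber type $F$ if there is a diffeomorphism $h:X\to F\times Y$ with $pr_2\circ h=f$. It is locally trivial of fiber type $F$ if there is a $D$-open cover $\{U_i\}$ of $Y$ such that each $f|_{f^{-1}(U_i)}:f^{-1}(U_i)\to U_i$ is trivial of fiber type $F$. A smooth surjective map $f:X\to Y$ is a diffeological bundle of fiber type $F$ if the pullback of $f$ along every plot of $Y$ is locally trivial of fiber type $F$; $F$ is called its fiber. Let $\mathbb{A}^n=\{(x_0,\dots,x_n)\in\mathbb{R}^{n+1}\mid\sum x_i=1\}$ with the sub-diffeology from $\mathbb{R}^{n+1}$.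 A map $f:\{0,\dots,n\}\to\{0,\dots,m\}$ in the simplicial category induces $f_*:\mathbb{A}^n\to\mathbb{A}^m$, $f_*(x)_j=\sum_{i\in f^{-1}(j)}x_i$. $S^D(X)$ is the simplicial set with $S^D_n(X)=C^\infty(\mathbb{A}^n,X)$ and structure maps given by precomposition. A smooth map $f$ is a fibration if $S^D(f)$ is a Kan fibration; a diffeological space $X$ is fibrant if $S^D(X)$ is a Kan complex. *)

theory Defs
  imports "HOL-Analysis.Analysis"
begin

text \<open>
  The dimension of a Euclidean space is a natural number varying inside the
  definitions below, so $R^n$ is the library's \<^const>\<open>Euclidean_space\<close>, whose
  points are the \<open>x :: nat \<Rightarrow> real\<close> with \<open>x i = 0\<close> for \<open>i \<ge> n\<close>.  A function on a set
  is represented by its unique representative in \<^const>\<open>extensional\<close> wherever sets of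
  functions are considered.
\<close>

section \<open>Smooth maps between open subsets of Euclidean spaces\<close>

definition partial_deriv :: "nat \<Rightarrow> ((nat \<Rightarrow> real) \<Rightarrow> real) \<Rightarrow> (nat \<Rightarrow> real) \<Rightarrow> real" where
  "partial_deriv i f x = deriv (\<lambda>t. f (x(i := t))) (x i)"

text \<open>\<open>Ck_on k n U f\<close>: all iterated partial derivatives of \<open>f\<close> of order at most \<open>k\<close>
  exist and are continuous on the open set \<open>U\<close> of $R^n$.  As \<open>U\<close> is open, the
  values of \<open>f\<close> outside \<open>U\<close> are irrelevant.\<close>

primrec Ck_on :: "nat \<Rightarrow> nat \<Rightarrow> (nat \<Rightarrow> real) set \<Rightarrow> ((nat \<Rightarrow> real) \<Rightarrow> real) \<Rightarrow> bool" where
  "Ck_on 0 n U f \<longleftrightarrow>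
     continuous_map (subtopology (Euclidean_space n) U) euclideanreal f"
| "Ck_on (Suc k) n U f \<longleftrightarrow>
     continuous_map (subtopology (Euclidean_space n) U) euclideanreal f \<and>
     (\<forall>i<n. (\<forall>x\<in>U. (\<lambda>t. f (x(i := t))) field_differentiable at (x i)) \<and>
            Ck_on k n U (partial_deriv i f))"

definition smooth_on :: "nat \<Rightarrow> (nat \<Rightarrow> real) set \<Rightarrow> nat \<Rightarrow> ((nat \<Rightarrow> real) \<Rightarrow> nat \<Rightarrow> real) \<Rightarrow> bool" where
  "smooth_on n U m f \<longleftrightarrow>
     f \<in> U \<rightarrow> topspace (Euclidean_space m) \<and> (\<forall>j<m. \<forall>k. Ck_on k n U (\<lambda>x. f x j))"

section \<open>Diffeological spaces\<close>

record 'a diffspace =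
  points :: "'a set"
  plots :: "nat \<Rightarrow> (nat \<Rightarrow> real) set \<Rightarrow> ((nat \<Rightarrow> real) \<Rightarrow> 'a) set"

text \<open>\<open>plots X n U\<close> is the set of plots \<open>U \<rightarrow> X\<close> for \<open>U\<close> open in $R^n$; by convention it
  is empty if \<open>U\<close> is not open.\<close>

locale diffeological_space =
  fixes X :: "'a diffspace"
  assumes plots_wf:
      "p \<in> plots X n U \<Longrightarrow> openin (Euclidean_space n) U \<and> p \<in> U \<rightarrow>\<^sub>E points X"
    and plots_const:
      "\<lbrakk>openin (Euclidean_space n) U; a \<in> points X\<rbrakk> \<Longrightarrow> (\<lambda>u\<in>U. a) \<in> plots X n U"
    and plots_compose:
      "\<lbrakk>p \<in> plots X n U; openin (Euclidean_space m) V; smooth_on m V n g; g \<in> V \<rightarrow> U\<rbrakk>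
       \<Longrightarrow> compose V p g \<in> plots X m V"
    and plots_local:
      "\<lbrakk>openin (Euclidean_space n) U; p \<in> U \<rightarrow>\<^sub>E points X; \<Union>\<V> = U;
        \<And>V. V \<in> \<V> \<Longrightarrow> openin (Euclidean_space n) V \<and> restrict p V \<in> plots X n V\<rbrakk>
       \<Longrightarrow> p \<in> plots X n U"

definition smooth_map :: "'a diffspace \<Rightarrow> 'b diffspace \<Rightarrow> ('a \<Rightarrow> 'b) \<Rightarrow> bool" where
  "smooth_map X Y f \<longleftrightarrow>
     f \<in> points X \<rightarrow> points Y \<and>
     (\<forall>n U. \<forall>p\<in>plots X n U. compose U f p \<in> plots Y n U)"

definition Cinf :: "'a diffspace \<Rightarrow> 'b diffspace \<Rightarrow> ('a \<Rightarrow> 'b) set" where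
  "Cinf X Y = {f \<in> extensional (points X). smooth_map X Y f}"

definition diffeomorphism :: "'a diffspace \<Rightarrow> 'b diffspace \<Rightarrow> ('a \<Rightarrow> 'b) \<Rightarrow> bool" where
  "diffeomorphism X Y h \<longleftrightarrow>
     smooth_map X Y h \<and>
     (\<exists>k. smooth_map Y X k \<and> (\<forall>x\<in>points X. k (h x) = x) \<and> (\<forall>y\<in>points Y. h (k y) = y))"

definition sub_diff :: "'a diffspace \<Rightarrow> 'a set \<Rightarrow> 'a diffspace" where
  "sub_diff X A =
     \<lparr>points = points X \<inter> A,
      plots = (\<lambda>n U. {p \<in> plots X n U. p ` U \<subseteq> A})\<rparr>"

definition prod_diff :: "'a diffspace \<Rightarrow> 'b diffspace \<Rightarrow> ('a \<times> 'b) diffspace" where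
  "prod_diff X Y =
     \<lparr>points = points X \<times> points Y,
      plots = (\<lambda>n U. {p \<in> U \<rightarrow>\<^sub>E points X \<times> points Y.
                        compose U fst p \<in> plots X n U \<and> compose U snd p \<in> plots Y n U})\<rparr>"

definition Eucl :: "nat \<Rightarrow> (nat \<Rightarrow> real) diffspace" where
  "Eucl m =
     \<lparr>points = topspace (Euclidean_space m),
      plots = (\<lambda>n U. {p \<in> U \<rightarrow>\<^sub>E topspace (Euclidean_space m).
                        openin (Euclidean_space n) U \<and> smooth_on n U m p})\<rparr>"

definition D_topology :: "'a diffspace \<Rightarrow> 'a topology" where
  "D_topology X = topology (\<lambda>A. A \<subseteq> points X \<and>
     (\<forall>n U. \<forall>p\<in>plots X n U. openin (Euclidean_space n) {u \<in> U. p u \<in> A}))"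

lemma openin_D_topology:
  "openin (D_topology X) A \<longleftrightarrow> A \<subseteq> points X \<and>
     (\<forall>n U. \<forall>p\<in>plots X n U. openin (Euclidean_space n) {u \<in> U. p u \<in> A})"
proof -
  let ?P = "\<lambda>A. A \<subseteq> points X \<and>
     (\<forall>n U. \<forall>p\<in>plots X n U. openin (Euclidean_space n) {u \<in> U. p u \<in> A})"
  have "istopology ?P"
    unfolding istopology_def
  proof (intro conjI allI impI ballI)
    fix S T n U p assume "?P S" "?P T" and p: "p \<in> plots X n U"
    then have "openin (Euclidean_space n) ({u \<in> U. p u \<in> S} \<inter> {u \<in> U. p u \<in> T})"
      by (intro openin_Int) blast+
    also have "{u \<in> U. p u \<in> S} \<inter> {u \<in> U. p u \<in> T} = {u \<in> U. p u \<in> S \<inter> T}"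
      by blast
    finally show "openin (Euclidean_space n) {u \<in> U. p u \<in> S \<inter> T}" .
  next
    fix \<K> n U p assume "\<forall>K\<in>\<K>. ?P K" and p: "p \<in> plots X n U"
    then have "openin (Euclidean_space n) (\<Union>K\<in>\<K>. {u \<in> U. p u \<in> K})"
      by (intro openin_Union) blast
    also have "(\<Union>K\<in>\<K>. {u \<in> U. p u \<in> K}) = {u \<in> U. p u \<in> \<Union>\<K>}"
      by blast
    finally show "openin (Euclidean_space n) {u \<in> U. p u \<in> \<Union>\<K>}" .
  qed blast+
  then show ?thesis
    unfolding D_topology_def by (simp add: topology_inverse')
qed

section \<open>Diffeological bundles\<close>

definition trivial_bundle :: "'c diffspace \<Rightarrow> 'a diffspace \<Rightarrow> 'b diffspace \<Rightarrow> ('a \<Rightarrow> 'b) \<Rightarrow> bool" where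
  "trivial_bundle F X Y f \<longleftrightarrow>
     smooth_map X Y f \<and>
     (\<exists>h. diffeomorphism X (prod_diff F Y) h \<and> (\<forall>x\<in>points X. snd (h x) = f x))"

definition locally_trivial_bundle ::
    "'c diffspace \<Rightarrow> 'a diffspace \<Rightarrow> 'b diffspace \<Rightarrow> ('a \<Rightarrow> 'b) \<Rightarrow> bool" where
  "locally_trivial_bundle F X Y f \<longleftrightarrow>
     smooth_map X Y f \<and>
     (\<exists>\<U>. (\<forall>U\<in>\<U>. openin (D_topology Y) U) \<and> \<Union>\<U> = points Y \<and>
          (\<forall>U\<in>\<U>. trivial_bundle F (sub_diff X (f -` U)) (sub_diff Y U) f))"

text \<open>The total space of the pullback of \<open>f : X \<rightarrow> Y\<close> along \<open>g : Z \<rightarrow> Y\<close>; the pulled back map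
  is \<^const>\<open>fst\<close>.\<close>

definition pullback_diff ::
    "'z diffspace \<Rightarrow> 'a diffspace \<Rightarrow> ('z \<Rightarrow> 'b) \<Rightarrow> ('a \<Rightarrow> 'b) \<Rightarrow> ('z \<times> 'a) diffspace" where
  "pullback_diff Z X g f = sub_diff (prod_diff Z X) {(z, x). g z = f x}"

definition diffeological_bundle ::
    "'c diffspace \<Rightarrow> 'a diffspace \<Rightarrow> 'b diffspace \<Rightarrow> ('a \<Rightarrow> 'b) \<Rightarrow> bool" where
  "diffeological_bundle F X Y f \<longleftrightarrow>
     smooth_map X Y f \<and> f ` points X = points Y \<and>
     (\<forall>n U. \<forall>p\<in>plots Y n U.
        locally_trivial_bundle F (pullback_diff (sub_diff (Eucl n) U) X p f)
          (sub_diff (Eucl n) U) fst)"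

section \<open>Simplicial sets and Kan fibrations\<close>

text \<open>\<open>Delta m n\<close> is the set of morphisms $[m] \to [n]$ of the simplicial category.\<close>

definition Delta :: "nat \<Rightarrow> nat \<Rightarrow> (nat \<Rightarrow> nat) set" where
  "Delta m n = {\<theta> \<in> {..m} \<rightarrow>\<^sub>E {..n}. mono_on {..m} \<theta>}"

text \<open>\<open>act S m n \<theta>\<close> is the structure map $S_n \to S_m$ induced by \<open>\<theta> \<in> Delta m n\<close>.\<close>

record 's sset =
  simplices :: "nat \<Rightarrow> 's set"
  act :: "nat \<Rightarrow> nat \<Rightarrow> (nat \<Rightarrow> nat) \<Rightarrow> 's \<Rightarrow> 's"

locale simplicial_set =
  fixes S :: "'s sset"
  assumes act_closed:
      "\<lbrakk>\<theta> \<in> Delta m n; s \<in> simplices S n\<rbrakk> \<Longrightarrow> act S m n \<theta> s \<in> simplices S m"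
    and act_id:
      "s \<in> simplices S n \<Longrightarrow> act S n n (\<lambda>i\<in>{..n}. i) s = s"
    and act_compose:
      "\<lbrakk>\<theta> \<in> Delta m n; \<eta> \<in> Delta l m; s \<in> simplices S n\<rbrakk>
       \<Longrightarrow> act S l n (compose {..l} \<theta> \<eta>) s = act S l m \<eta> (act S m n \<theta> s)"

definition simplicial_map :: "'s sset \<Rightarrow> 't sset \<Rightarrow> (nat \<Rightarrow> 's \<Rightarrow> 't) \<Rightarrow> bool" where
  "simplicial_map S T \<phi> \<longleftrightarrow>
     (\<forall>n. \<phi> n \<in> simplices S n \<rightarrow> simplices T n) \<and>
     (\<forall>m n. \<forall>\<theta>\<in>Delta m n. \<forall>s\<in>simplices S n. \<phi> m (act S m n \<theta> s) = act T m n \<theta> (\<phi> n s))"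

definition std_simplex :: "nat \<Rightarrow> (nat \<Rightarrow> nat) sset" where
  "std_simplex n =
     \<lparr>simplices = (\<lambda>m. Delta m n), act = (\<lambda>l m \<eta> \<theta>. compose {..l} \<theta> \<eta>)\<rparr>"

text \<open>The \<open>k\<close>-th horn is the union of the faces of the standard simplex opposite to the
  vertices \<open>i \<noteq> k\<close>.\<close>

definition horn :: "nat \<Rightarrow> nat \<Rightarrow> (nat \<Rightarrow> nat) sset" where
  "horn n k =
     \<lparr>simplices = (\<lambda>m. {\<theta> \<in> Delta m n. \<exists>i\<le>n. i \<noteq> k \<and> i \<notin> \<theta> ` {..m}}),
      act = (\<lambda>l m \<eta> \<theta>. compose {..l} \<theta> \<eta>)\<rparr>"

definition Kan_complex :: "'s sset \<Rightarrow> bool" where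
  "Kan_complex S \<longleftrightarrow> simplicial_set S \<and>
     (\<forall>n\<ge>1. \<forall>k\<le>n. \<forall>\<alpha>. simplicial_map (horn n k) S \<alpha> \<longrightarrow>
        (\<exists>\<gamma>. simplicial_map (std_simplex n) S \<gamma> \<and>
             (\<forall>m. \<forall>\<theta>\<in>simplices (horn n k) m. \<gamma> m \<theta> = \<alpha> m \<theta>)))"

definition Kan_fibration :: "'s sset \<Rightarrow> 't sset \<Rightarrow> (nat \<Rightarrow> 's \<Rightarrow> 't) \<Rightarrow> bool" where
  "Kan_fibration S T \<phi> \<longleftrightarrow> simplicial_set S \<and> simplicial_set T \<and> simplicial_map S T \<phi> \<and>
     (\<forall>n\<ge>1. \<forall>k\<le>n. \<forall>\<alpha> \<beta>.
        simplicial_map (horn n k) S \<alpha> \<and> simplicial_map (std_simplex n) T \<beta> \<and>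
        (\<forall>m. \<forall>\<theta>\<in>simplices (horn n k) m. \<phi> m (\<alpha> m \<theta>) = \<beta> m \<theta>) \<longrightarrow>
        (\<exists>\<gamma>. simplicial_map (std_simplex n) S \<gamma> \<and>
             (\<forall>m. \<forall>\<theta>\<in>simplices (horn n k) m. \<gamma> m \<theta> = \<alpha> m \<theta>) \<and>
             (\<forall>m. \<forall>\<theta>\<in>simplices (std_simplex n) m. \<phi> m (\<gamma> m \<theta>) = \<beta> m \<theta>)))"

section \<open>The smooth singular simplicial set\<close>

definition affine_simplex :: "nat \<Rightarrow> (nat \<Rightarrow> real) diffspace" where
  "affine_simplex n = sub_diff (Eucl (Suc n)) {x. (\<Sum>i\<le>n. x i) = 1}"

definition affine_map :: "nat \<Rightarrow> (nat \<Rightarrow> nat) \<Rightarrow> (nat \<Rightarrow> real) \<Rightarrow> nat \<Rightarrow> real" where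
  "affine_map m \<theta> x = (\<lambda>j. \<Sum>i\<in>{i. i \<le> m \<and> \<theta> i = j}. x i)"

definition SD :: "'a diffspace \<Rightarrow> ((nat \<Rightarrow> real) \<Rightarrow> 'a) sset" where
  "SD X =
     \<lparr>simplices = (\<lambda>n. Cinf (affine_simplex n) X),
      act = (\<lambda>m n \<theta> \<sigma>. compose (points (affine_simplex m)) \<sigma> (affine_map m \<theta>))\<rparr>"

definition SD_map :: "('a \<Rightarrow> 'b) \<Rightarrow> nat \<Rightarrow> ((nat \<Rightarrow> real) \<Rightarrow> 'a) \<Rightarrow> (nat \<Rightarrow> real) \<Rightarrow> 'b" where
  "SD_map f n \<sigma> = compose (points (affine_simplex n)) f \<sigma>"

definition fibrant :: "'a diffspace \<Rightarrow> bool" where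
  "fibrant X \<longleftrightarrow> Kan_complex (SD X)"

definition diff_fibration :: "'a diffspace \<Rightarrow> 'b diffspace \<Rightarrow> ('a \<Rightarrow> 'b) \<Rightarrow> bool" where
  "diff_fibration X Y f \<longleftrightarrow> smooth_map X Y f \<and> Kan_fibration (SD X) (SD Y) (SD_map f)"

end

theory Submission
  imports Defs
begin

text \<open>
  The proof rests on the fact that every locally trivial family over a Euclidean space is trivial
  (\<open>locally_trivial_over_Rn_trivial\<close>).  Given this, let a horn in \<open>X\<close> and a simplex \<open>\<sigma>\<close> of \<open>Y\<close> extending
  its image be given.  The affine simplex is a smooth retract of $R^{n+1}$, so \<open>\<sigma>\<close> extends to a plot
  of \<open>Y\<close> on $R^{n+1}$.  The pullback of \<open>f\<close> along this plot is locally trivial, hence trivial, and the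
  lifting problem becomes that of filling a horn in \<open>F\<close>, which is possible since \<open>F\<close> is fibrant
  (\<open>Kan_fibration_SD_lift\<close>).

  Triviality over $R^n$ is proved by gluing.  Suppose that trivialisations over open sets \<open>A\<close> and \<open>B\<close> are
  given by diffeomorphisms to products with \<open>F\<close>, and that \<open>\<rho>\<close> is a smooth map from \<open>B\<close> to the
  intersection of \<open>A\<close> and \<open>B\<close>.  Over the intersection, the two trivialisations differ by a family \<open>g\<close> of
  diffeomorphisms of \<open>F\<close>; changing the trivialisation over \<open>B\<close> by \<open>g (\<rho> u)\<close> at every point \<open>u\<close> makes it
  agree with the one over \<open>A\<close> wherever \<open>\<rho>\<close> is the identity (\<open>chart_modify\<close>).  Maps \<open>\<rho>\<close> that are
  the identity on a large part of a box are obtained from a smooth cut-off function of one variable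
  (\<open>smooth_cutoff_above\<close>).  In this way, trivialisations over two boxes that overlap in one coordinate
  direction are combined (\<open>trivial_over_join_boxes\<close>); a compactness argument in one coordinate after the
  other gives triviality over every bounded box (\<open>trivial_near_closed_box\<close>); and exhausting
  $R^n$ by cubes gives triviality over $R^n$ (\<open>trivial_over_Rn\<close>).
\<close>

section \<open>Smooth functions of several variables\<close>

text \<open>The points of $R^n$.  The set has a name of its own, so that the topology of
  $R^n$ can be rewritten to a subspace topology of \<^typ>\<open>nat \<Rightarrow> real\<close>.\<close>

definition Rn :: "nat \<Rightarrow> (nat \<Rightarrow> real) set" where
  "Rn n = {x. \<forall>i\<ge>n. x i = 0}"

lemma topspace_Rn [simp]: "topspace (Euclidean_space n) = Rn n"
  by (simp add: topspace_Euclidean_space Rn_def)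

lemma Rn_iff: "x \<in> Rn n \<longleftrightarrow> (\<forall>i\<ge>n. x i = 0)"
  by (simp add: Rn_def)

lemma Euclidean_space_eq: "Euclidean_space n = top_of_set (Rn n)"
  by (simp add: Rn_def Euclidean_space_def euclidean_product_topology)

lemma continuous_map_Euclidean_iff:
  assumes "U \<subseteq> Rn n"
  shows "continuous_map (subtopology (Euclidean_space n) U) euclideanreal f \<longleftrightarrow> continuous_on U f"
  using assms by (simp add: Euclidean_space_eq subtopology_subtopology inf.absorb2)

lemma openin_Euclidean_subset: "openin (Euclidean_space n) U \<Longrightarrow> U \<subseteq> Rn n"
  using openin_subset[of "Euclidean_space n" U] by simp

lemma open_coordinate_line:
  assumes U: "openin (Euclidean_space n) U" and x: "x \<in> U" and i: "i < n"
  shows "eventually (\<lambda>t. x(i := t) \<in> U) (nhds (x i))"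
proof -
  obtain W where W: "open W" "U = Rn n \<inter> W"
    using U unfolding Euclidean_space_eq openin_open by auto
  have "continuous_on UNIV (\<lambda>t. x(i := t))"
  proof (rule continuous_on_coordinatewise_then_product)
    show "continuous_on UNIV (\<lambda>t. (x(i := t)) j)" for j
      by (cases "j = i") auto
  qed
  then have "open ((\<lambda>t. x(i := t)) -` W)"
    using W(1) by (simp add: continuous_on_open_vimage)
  moreover have "x i \<in> (\<lambda>t. x(i := t)) -` W"
    using x W by simp
  ultimately have "eventually (\<lambda>t. t \<in> (\<lambda>t. x(i := t)) -` W) (nhds (x i))"
    by (rule eventually_nhds_in_open)
  then show ?thesis
  proof eventually_elim
    case (elim t)
    have "x(i := t) \<in> Rn n"
      using x W i by (auto simp: Rn_iff)
    with elim W show ?case by auto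
  qed
qed

lemma Ck_on_continuous: "Ck_on k n U f \<Longrightarrow> U \<subseteq> Rn n \<Longrightarrow> continuous_on U f"
  by (cases k) (auto simp: continuous_map_Euclidean_iff)

lemma Ck_on_cong_aux:
  assumes "openin (Euclidean_space n) U" and "\<And>x. x \<in> U \<Longrightarrow> f x = g x" and "Ck_on k n U f"
  shows "Ck_on k n U g"
  using assms(2,3)
proof (induction k arbitrary: f g)
  case 0
  then show ?case
    using openin_Euclidean_subset[OF assms(1)]
    by (auto simp: continuous_map_Euclidean_iff elim: continuous_on_eq)
next
  case (Suc k)
  have near: "eventually (\<lambda>t. f (x(i := t)) = g (x(i := t))) (nhds (x i))"
    if "x \<in> U" "i < n" for x i
    using open_coordinate_line[OF assms(1) that] by eventually_elim (rule Suc.prems(1))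
  have pd: "partial_deriv i f x = partial_deriv i g x" if "x \<in> U" "i < n" for x i
    unfolding partial_deriv_def by (rule deriv_cong_ev[OF near[OF that] refl])
  have fd: "(\<lambda>t. g (x(i := t))) field_differentiable at (x i)" if "x \<in> U" "i < n" for x i
  proof -
    have "(\<lambda>t. f (x(i := t))) field_differentiable at (x i)"
      using Suc.prems(2) that by simp
    then show ?thesis
      unfolding field_differentiable_def
      using DERIV_cong_ev[OF refl near[OF that] refl] by auto
  qed
  have "continuous_on U g"
    using Ck_on_continuous[OF Suc.prems(2) openin_Euclidean_subset[OF assms(1)]] Suc.prems(1)
    by (auto elim: continuous_on_eq)
  then show ?case
    using fd pd Suc.IH[where f = "partial_deriv i f" and g = "partial_deriv i g" for i] Suc.prems(2)
      openin_Euclidean_subset[OF assms(1)]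
    by (auto simp: continuous_map_Euclidean_iff)
qed

lemma Ck_on_cong:
  assumes "openin (Euclidean_space n) U" and "\<And>x. x \<in> U \<Longrightarrow> f x = g x"
  shows "Ck_on k n U f \<longleftrightarrow> Ck_on k n U g"
  using Ck_on_cong_aux[OF assms(1), of f g k] Ck_on_cong_aux[OF assms(1), of g f k] assms(2) by auto

text \<open>A function is $C^{k+1}$ as soon as some $C^k$ functions are its partial derivatives.  This form
  avoids computing with \<^const>\<open>partial_deriv\<close>.\<close>

lemma Ck_on_SucI:
  assumes "openin (Euclidean_space n) U" and "continuous_on U f"
    and "\<And>x i. x \<in> U \<Longrightarrow> i < n \<Longrightarrow> ((\<lambda>t. f (x(i := t))) has_real_derivative f' i x) (at (x i))"
    and "\<And>i. i < n \<Longrightarrow> Ck_on k n U (f' i)"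
  shows "Ck_on (Suc k) n U f"
proof -
  have "Ck_on k n U (partial_deriv i f)" if "i < n" for i
    using assms(3)[OF _ that, THEN DERIV_imp_deriv]
    by (intro Ck_on_cong_aux[OF assms(1) _ assms(4)[OF that]]) (simp add: partial_deriv_def)
  then show ?thesis
    using assms openin_Euclidean_subset[OF assms(1)]
    by (auto simp: continuous_map_Euclidean_iff field_differentiable_def)
qed

lemma Ck_on_SucD:
  assumes "Ck_on (Suc k) n U f" and "i < n"
  shows "Ck_on k n U (partial_deriv i f)"
    and "x \<in> U \<Longrightarrow>
      ((\<lambda>t. f (x(i := t))) has_real_derivative partial_deriv i f x) (at (x i))"
  using assms by (auto simp: partial_deriv_def field_differentiable_derivI)

lemma Ck_on_Suc_imp: "Ck_on (Suc k) n U f \<Longrightarrow> Ck_on k n U f"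
proof (induction k arbitrary: f)
  case (Suc k)
  have "Ck_on k n U (partial_deriv i f)" if "i < n" for i
    using Ck_on_SucD(1)[OF Suc.prems that] by (rule Suc.IH)
  with Suc.prems show ?case
    by (subst Ck_on.simps(2)) (simp only: Ck_on.simps(2), blast)
qed simp

lemma Ck_on_subset: "Ck_on k n U f \<Longrightarrow> V \<subseteq> U \<Longrightarrow> Ck_on k n V f"
proof (induction k arbitrary: f)
  case 0
  then show ?case by (auto intro: continuous_map_from_subtopology_mono)
next
  case (Suc k)
  then show ?case by (auto intro: continuous_map_from_subtopology_mono)
qed

lemma Ck_on_Union:
  assumes "\<And>V. V \<in> \<V> \<Longrightarrow> openin (Euclidean_space n) V"
    and "\<And>V. V \<in> \<V> \<Longrightarrow> Ck_on k n V f"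
  shows "Ck_on k n (\<Union>\<V>) f"
proof -
  have cont: "continuous_map (subtopology (Euclidean_space n) (\<Union>\<V>)) euclideanreal f"
    if "\<And>V. V \<in> \<V> \<Longrightarrow> continuous_map (subtopology (Euclidean_space n) V) euclideanreal f" for f
  proof (rule pasting_lemma[where I = \<V> and T = "\<lambda>V. V" and f = "\<lambda>_. f"])
    fix V assume V: "V \<in> \<V>"
    then have "V \<subseteq> \<Union>\<V>" by blast
    then show "openin (subtopology (Euclidean_space n) (\<Union>\<V>)) V"
      using assms(1)[OF V] by (simp add: openin_subset_topspace_eq openin_subtopology_alt image_iff) blast
    show "continuous_map (subtopology (subtopology (Euclidean_space n) (\<Union>\<V>)) V) euclideanreal f"
      using that[OF V] \<open>V \<subseteq> \<Union>\<V>\<close> by (simp add: subtopology_subtopology inf.absorb2)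
  qed auto
  show ?thesis
    using assms(2)
  proof (induction k arbitrary: f)
    case 0
    then show ?case by (auto intro: cont)
  next
    case (Suc k)
    then show ?case by (auto intro!: cont)
  qed
qed

lemma Ck_on_const: "openin (Euclidean_space n) U \<Longrightarrow> Ck_on k n U (\<lambda>x. c)"
proof (induction k arbitrary: c)
  case (Suc k)
  show ?case
    by (rule Ck_on_SucI[where f' = "\<lambda>i x. 0"]) (use Suc in auto)
qed (simp add: continuous_map_Euclidean_iff openin_Euclidean_subset)

lemma Ck_on_coord:
  assumes "openin (Euclidean_space n) U"
  shows "Ck_on k n U (\<lambda>x. x j)"
proof -
  have cont: "continuous_on U (\<lambda>x. x j)"
    by (rule continuous_on_subset[OF continuous_on_product_coordinates]) simp
  show ?thesis
  proof (cases k)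
    case 0
    with cont show ?thesis
      by (simp add: continuous_map_Euclidean_iff openin_Euclidean_subset[OF assms])
  next
    case (Suc k')
    show ?thesis
      unfolding Suc
    proof (rule Ck_on_SucI[where f' = "\<lambda>i x. if i = j then 1 else 0"])
      show "((\<lambda>t. (x(i := t)) j) has_real_derivative (if i = j then 1 else 0)) (at (x i))" for x i
        by (cases "i = j") auto
    qed (use assms cont in \<open>auto intro: Ck_on_const\<close>)
  qed
qed

lemma Ck_on_add:
  assumes "openin (Euclidean_space n) U" and "Ck_on k n U f" and "Ck_on k n U g"
  shows "Ck_on k n U (\<lambda>x. f x + g x)"
  using assms(2,3)
proof (induction k arbitrary: f g)
  case 0
  then show ?case
    by (auto simp: continuous_map_Euclidean_iff openin_Euclidean_subset[OF assms(1)] intro: continuous_on_add)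
next
  case (Suc k)
  note SucD = Ck_on_SucD[OF Suc.prems(1)] Ck_on_SucD[OF Suc.prems(2)]
  show ?case
  proof (rule Ck_on_SucI[OF assms(1), where f' = "\<lambda>i x. partial_deriv i f x + partial_deriv i g x"])
    show "continuous_on U (\<lambda>x. f x + g x)"
      using Suc.prems[THEN Ck_on_continuous, OF openin_Euclidean_subset[OF assms(1)]]
      by (rule continuous_on_add)
    show "((\<lambda>t. f (x(i := t)) + g (x(i := t))) has_real_derivative
        partial_deriv i f x + partial_deriv i g x) (at (x i))" if "x \<in> U" "i < n" for x i
      by (rule DERIV_add[OF SucD(2)[OF that(2,1)] SucD(4)[OF that(2,1)]])
  qed (rule Suc.IH[OF SucD(1,3)])
qed

lemma Ck_on_mult:
  assumes "openin (Euclidean_space n) U" and "Ck_on k n U f" and "Ck_on k n U g"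
  shows "Ck_on k n U (\<lambda>x. f x * g x)"
  using assms(2,3)
proof (induction k arbitrary: f g)
  case 0
  then show ?case
    by (auto simp: continuous_map_Euclidean_iff openin_Euclidean_subset[OF assms(1)] intro: continuous_on_mult)
next
  case (Suc k)
  note SucD = Ck_on_SucD[OF Suc.prems(1)] Ck_on_SucD[OF Suc.prems(2)]
  show ?case
  proof (rule Ck_on_SucI[OF assms(1),
        where f' = "\<lambda>i x. partial_deriv i f x * g x + partial_deriv i g x * f x"])
    show "continuous_on U (\<lambda>x. f x * g x)"
      using Suc.prems[THEN Ck_on_continuous, OF openin_Euclidean_subset[OF assms(1)]]
      by (rule continuous_on_mult)
    show "((\<lambda>t. f (x(i := t)) * g (x(i := t))) has_real_derivative
        partial_deriv i f x * g x + partial_deriv i g x * f x) (at (x i))" if "x \<in> U" "i < n" for x i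
    proof -
      have "((\<lambda>t. f (x(i := t)) * g (x(i := t))) has_real_derivative
        partial_deriv i f x * g (x(i := x i)) + partial_deriv i g x * f (x(i := x i))) (at (x i))"
        by (rule DERIV_mult[OF SucD(2)[OF that(2,1)] SucD(4)[OF that(2,1)]])
      then show ?thesis by (simp only: fun_upd_triv)
    qed
    show "Ck_on k n U (\<lambda>x. partial_deriv i f x * g x + partial_deriv i g x * f x)" if "i < n" for i
      by (intro Ck_on_add[OF assms(1)] Suc.IH SucD[OF that] Suc.prems[THEN Ck_on_Suc_imp])
  qed
qed

lemma Ck_on_sum:
  assumes "openin (Euclidean_space n) U" and "finite I" and "\<And>i. i \<in> I \<Longrightarrow> Ck_on k n U (f i)"
  shows "Ck_on k n U (\<lambda>x. \<Sum>i\<in>I. f i x)"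
  using assms(2,3)
  by (induction I rule: finite_induct) (auto intro: Ck_on_const Ck_on_add assms(1))

lemma Ck_on_inverse:
  assumes "openin (Euclidean_space n) U" and "Ck_on k n U f" and nz: "\<And>x. x \<in> U \<Longrightarrow> f x \<noteq> 0"
  shows "Ck_on k n U (\<lambda>x. inverse (f x))"
  using assms(2)
proof (induction k)
  case 0
  then show ?case
    using nz by (auto simp: continuous_map_Euclidean_iff openin_Euclidean_subset[OF assms(1)]
        intro: continuous_on_inverse)
next
  case (Suc k)
  note SucD = Ck_on_SucD[OF Suc.prems]
  have IH: "Ck_on k n U (\<lambda>x. inverse (f x))"
    using Suc.IH Suc.prems[THEN Ck_on_Suc_imp] .
  show ?case
  proof (rule Ck_on_SucI[OF assms(1), where
        f' = "\<lambda>i x. (- 1) * (inverse (f x) * (partial_deriv i f x * inverse (f x)))"])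
    show "continuous_on U (\<lambda>x. inverse (f x))"
      using Ck_on_continuous[OF Suc.prems openin_Euclidean_subset[OF assms(1)]] nz
      by (auto intro: continuous_on_inverse)
    show "((\<lambda>t. inverse (f (x(i := t)))) has_real_derivative
        (- 1) * (inverse (f x) * (partial_deriv i f x * inverse (f x)))) (at (x i))"
      if "x \<in> U" "i < n" for x i
    proof -
      have "((\<lambda>t. inverse (f (x(i := t)))) has_real_derivative
        - (inverse (f (x(i := x i))) * partial_deriv i f x * inverse (f (x(i := x i))))) (at (x i))"
        by (rule DERIV_inverse'[OF SucD(2)[OF that(2,1)]]) (use nz[OF that(1)] in simp)
      then show ?thesis by (simp only: fun_upd_triv mult.assoc mult_minus1)
    qed
    show "Ck_on k n U (\<lambda>x. (- 1) * (inverse (f x) * (partial_deriv i f x * inverse (f x))))"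
      if "i < n" for i
      by (intro Ck_on_mult[OF assms(1)] Ck_on_const[OF assms(1)] IH SucD(1)[OF that])
  qed
qed

subsection \<open>A smooth cut-off\<close>

text \<open>\<open>flat j\<close> is the function $s^{-j} e^{-1/s}$ on the positive half line, extended by zero.  The whole
  family is considered because it is closed under differentiation up to linear combinations:
  the derivative of \<open>flat j\<close> is \<open>flat (j + 2) - j * flat (j + 1)\<close>.\<close>

definition flat :: "nat \<Rightarrow> real \<Rightarrow> real" where
  "flat j s = (if 0 < s then inverse s ^ j * exp (- inverse s) else 0)"

lemma flat_tendsto_0: "((\<lambda>s. flat j s) \<longlongrightarrow> 0) (at 0)"
proof -
  have "((\<lambda>y. y ^ j * exp (- y)) \<longlongrightarrow> (0::real)) at_top"
    using tendsto_power_div_exp_0[of j] by (simp add: exp_minus divide_inverse)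
  then have "((\<lambda>s. inverse s ^ j * exp (- inverse s)) \<longlongrightarrow> (0::real)) (at_right 0)"
    using filterlim_compose[OF _ filterlim_inverse_at_top_right] by fastforce
  moreover have "eventually (\<lambda>s. inverse s ^ j * exp (- inverse s) = flat j s) (at_right (0::real))"
    by (auto simp: flat_def eventually_at_right_field intro!: exI[of _ 1])
  ultimately have "((\<lambda>s. flat j s) \<longlongrightarrow> 0) (at_right 0)"
    by (rule Lim_transform_eventually)
  moreover have "eventually (\<lambda>s. 0 = flat j s) (at_left (0::real))"
    by (auto simp: flat_def eventually_at_left_field intro!: exI[of _ "-1"])
  then have "((\<lambda>s. flat j s) \<longlongrightarrow> 0) (at_left 0)"
    by (rule Lim_transform_eventually[OF tendsto_const])
  ultimately show ?thesis
    by (simp add: filterlim_at_split)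
qed

lemma flat_deriv: "(flat j has_real_derivative flat (j + 2) s - real j * flat (j + 1) s) (at s)"
proof -
  consider "s > 0" | "s < 0" | "s = 0" by linarith
  then show ?thesis
  proof cases
    case 1
    then have "eventually (\<lambda>t. t \<in> {0<..}) (nhds s)"
      by (intro eventually_nhds_in_open) auto
    then have ev: "eventually (\<lambda>t. inverse t ^ j * exp (- inverse t) = flat j t) (nhds s)"
      by eventually_elim (simp add: flat_def)
    have inv: "(inverse has_real_derivative - (inverse s * inverse s)) (at s)"
      using DERIV_inverse[of s] 1 by (simp add: power2_eq_square)
    have "((\<lambda>t. inverse t ^ j) has_real_derivative - (real j * inverse s ^ (j + 1))) (at s)"
    proof (cases j)
      case (Suc i)
      show ?thesis
        using DERIV_power_Suc[OF inv, of i] by (simp add: Suc algebra_simps)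
    qed simp
    moreover have "((\<lambda>t. exp (- inverse t)) has_real_derivative
        exp (- inverse s) * (inverse s * inverse s)) (at s)"
      by (rule DERIV_cong[OF DERIV_fun_exp[OF DERIV_minus[OF inv]]]) simp
    ultimately have "((\<lambda>t. inverse t ^ j * exp (- inverse t)) has_real_derivative
        - (real j * inverse s ^ (j + 1)) * exp (- inverse s)
        + exp (- inverse s) * (inverse s * inverse s) * inverse s ^ j) (at s)"
      by (rule DERIV_mult)
    also have "- (real j * inverse s ^ (j + 1)) * exp (- inverse s)
        + exp (- inverse s) * (inverse s * inverse s) * inverse s ^ j
      = flat (j + 2) s - real j * flat (j + 1) s"
      using 1 by (simp add: flat_def algebra_simps)
    finally have "((\<lambda>t. inverse t ^ j * exp (- inverse t)) has_real_derivative
        flat (j + 2) s - real j * flat (j + 1) s) (at s)" .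
    then show ?thesis
      using DERIV_cong_ev[OF refl ev refl] by simp
  next
    case 2
    then have "eventually (\<lambda>t. t \<in> {..<0}) (nhds s)"
      by (intro eventually_nhds_in_open) auto
    then have ev: "eventually (\<lambda>t. 0 = flat j t) (nhds s)"
      by eventually_elim (simp add: flat_def)
    have "((\<lambda>t. 0) has_real_derivative flat (j + 2) s - real j * flat (j + 1) s) (at s)"
      using 2 by (simp add: flat_def)
    then show ?thesis
      using DERIV_cong_ev[OF refl ev refl] by simp
  next
    case 3
    have "eventually (\<lambda>h. flat (Suc j) h = (flat j (0 + h) - flat j 0) / h) (at 0)"
      by (auto simp: flat_def field_simps)
    then have "((\<lambda>h. (flat j (0 + h) - flat j 0) / h) \<longlongrightarrow> 0) (at 0)"
      by (rule Lim_transform_eventually[OF flat_tendsto_0])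
    then show ?thesis
      using 3 by (simp add: DERIV_def flat_def)
  qed
qed

lemma Ck_on_flat:
  assumes "openin (Euclidean_space n) U" and "Ck_on k n U f"
  shows "Ck_on k n U (\<lambda>x. flat j (f x))"
  using assms(2)
proof (induction k arbitrary: j)
  case 0
  have "continuous_on UNIV (flat j)"
    by (meson DERIV_isCont continuous_at_imp_continuous_on flat_deriv)
  then show ?case
    using 0 by (auto simp: continuous_map_Euclidean_iff openin_Euclidean_subset[OF assms(1)]
        intro: continuous_on_compose2)
next
  case (Suc k)
  note SucD = Ck_on_SucD[OF Suc.prems]
  show ?case
  proof (rule Ck_on_SucI[OF assms(1), where f' = "\<lambda>i x.
        (flat (j + 2) (f x) + (- real j) * flat (j + 1) (f x)) * partial_deriv i f x"])
    have "continuous_on UNIV (flat j)"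
      by (meson DERIV_isCont continuous_at_imp_continuous_on flat_deriv)
    then show "continuous_on U (\<lambda>x. flat j (f x))"
      using Ck_on_continuous[OF Suc.prems openin_Euclidean_subset[OF assms(1)]]
      by (auto intro: continuous_on_compose2)
    show "((\<lambda>t. flat j (f (x(i := t)))) has_real_derivative
        (flat (j + 2) (f x) + (- real j) * flat (j + 1) (f x)) * partial_deriv i f x) (at (x i))"
      if "x \<in> U" "i < n" for x i
    proof -
      have "(flat j has_real_derivative flat (j + 2) (f x) + (- real j) * flat (j + 1) (f x))
          (at (f (x(i := x i))))"
        using flat_deriv[of j "f x"] by simp
      from DERIV_chain2[OF this SucD(2)[OF that(2,1)]] show ?thesis .
    qed
    show "Ck_on k n U (\<lambda>x. (flat (j + 2) (f x) + (- real j) * flat (j + 1) (f x)) * partial_deriv i f x)"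
      if "i < n" for i
      by (intro Ck_on_mult[OF assms(1)] Ck_on_add[OF assms(1)] Ck_on_const[OF assms(1)]
          Suc.IH[OF Suc.prems[THEN Ck_on_Suc_imp]] SucD(1)[OF that])
  qed
qed

text \<open>Smoothness of a function of one variable, encoded by its action: postcomposition preserves
  $C^k$ functions of several variables.  No general chain rule is needed below.\<close>

definition smooth_fun :: "(real \<Rightarrow> real) \<Rightarrow> bool" where
  "smooth_fun r \<longleftrightarrow> (\<forall>k n U f. openin (Euclidean_space n) U \<longrightarrow> Ck_on k n U f \<longrightarrow>
     Ck_on k n U (\<lambda>x. r (f x)))"

lemma smooth_fun_id: "smooth_fun (\<lambda>t. t)"
  by (simp add: smooth_fun_def)

lemma smooth_fun_minus: "smooth_fun r \<Longrightarrow> smooth_fun (\<lambda>t. - r t)"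
  using Ck_on_mult[OF _ Ck_on_const[where c = "- 1"]] by (fastforce simp: smooth_fun_def)

lemma smooth_fun_compose: "smooth_fun r \<Longrightarrow> smooth_fun q \<Longrightarrow> smooth_fun (\<lambda>t. r (q t))"
  by (simp add: smooth_fun_def)

text \<open>A smooth map of the line that is the identity below \<open>c\<close> and maps everything above \<open>c\<close> into the
  interval from \<open>c\<close> to \<open>b\<close>.  It retracts an interval into a smaller one while fixing a large part.\<close>

lemma smooth_cutoff_above:
  fixes c b :: real
  assumes "c < b"
  obtains r where "smooth_fun r" and "\<And>t. t \<le> c \<Longrightarrow> r t = t" and "\<And>t. c < t \<Longrightarrow> c \<le> r t \<and> r t < b"
proof
  \<comment> \<open>With \<open>s = t - c\<close>, the summand $s / (1 + K s e^{-1/s})$ is below \<open>s\<close>, which settles \<open>s < b - c\<close>; for larger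
    \<open>s\<close> it is below $1 / (K e^{-1/s})$, and \<open>K\<close> makes this at most \<open>b - c\<close>.\<close>
  define K where "K = inverse ((b - c) * flat 0 (b - c))"
  define r where "r t = c + (t - c) * inverse (1 + K * ((t - c) * flat 0 (t - c)))" for t
  have pos: "0 < flat 0 s" if "0 < s" for s
    using that by (simp add: flat_def)
  have K: "0 < K" "K * ((b - c) * flat 0 (b - c)) = 1"
    using assms pos[of "b - c"] by (auto simp: K_def simp del: inverse_mult_distrib)
  have den: "1 + K * ((t - c) * flat 0 (t - c)) \<ge> 1" for t
    using K(1) by (simp add: flat_def)
  show "r t = t" if "t \<le> c" for t
    using that by (simp add: r_def flat_def)
  show "c \<le> r t \<and> r t < b" if t: "c < t" for t
  proof
    let ?s = "t - c"
    show "c \<le> r t"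
      unfolding r_def using t den[of t] by simp
    have s: "0 < ?s" using t by simp
    have "?s < (b - c) * (1 + K * (?s * flat 0 ?s))"
    proof (cases "?s < b - c")
      case True
      have "(b - c) * 1 \<le> (b - c) * (1 + K * (?s * flat 0 ?s))"
        using den[of t] assms by (intro mult_left_mono) auto
      with True show ?thesis by simp
    next
      case False
      have "flat 0 (b - c) \<le> flat 0 ?s"
        using False assms by (simp add: flat_def)
      then have "K * ((b - c) * (?s * flat 0 (b - c))) \<le> K * ((b - c) * (?s * flat 0 ?s))"
        using K(1) assms s by (intro mult_left_mono) auto
      moreover have "K * ((b - c) * (?s * flat 0 (b - c))) = ?s"
        using K(2) by (metis mult.left_commute mult.right_neutral)
      ultimately show ?thesis
        using assms by (simp add: algebra_simps)
    qed
    then have "?s * inverse (1 + K * (?s * flat 0 ?s)) < b - c"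
      using den[of t] by (simp add: divide_inverse[symmetric] pos_divide_less_eq)
    then show "r t < b"
      by (simp add: r_def)
  qed
  show "smooth_fun r"
    unfolding smooth_fun_def r_def
  proof (intro allI impI)
    fix k n U f assume U: "openin (Euclidean_space n) U" and f: "Ck_on k n U f"
    have s: "Ck_on k n U (\<lambda>x. f x - c)"
      using Ck_on_add[OF U f Ck_on_const[OF U, of k "- c"]] by simp
    show "Ck_on k n U (\<lambda>x. c + (f x - c) * inverse (1 + K * ((f x - c) * flat 0 (f x - c))))"
      by (intro Ck_on_add[OF U] Ck_on_mult[OF U] Ck_on_inverse[OF U] Ck_on_const[OF U]
          Ck_on_flat[OF U] s) (use den in \<open>smt (verit)\<close>)
  qed
qed

lemma smooth_cutoff:
  fixes c b :: real
  assumes "0 \<le> c" "c < b"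
  obtains r where "smooth_fun r" and "\<And>t. \<bar>t\<bar> \<le> c \<Longrightarrow> r t = t" and "\<And>t. \<bar>r t\<bar> < b"
proof -
  obtain q where q: "smooth_fun q" "\<And>t. t \<le> c \<Longrightarrow> q t = t" "\<And>t. c < t \<Longrightarrow> c \<le> q t \<and> q t < b"
    using smooth_cutoff_above[OF assms(2)] by blast
  show thesis
  proof
    \<comment> \<open>Cut off above, reflect, cut off above again and reflect back.\<close>
    show "smooth_fun (\<lambda>t. - q (- q t))"
      using smooth_fun_minus[OF smooth_fun_compose[OF q(1) smooth_fun_minus[OF q(1)]]] .
    show "- q (- q t) = t" if "\<bar>t\<bar> \<le> c" for t
      using that q(2)[of t] q(2)[of "- t"] by simp
    show "\<bar>- q (- q t)\<bar> < b" for t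
      using q(2)[of t] q(3)[of t] q(2)[of "- q t"] q(3)[of "- q t"] assms
      by (smt (verit))
  qed
qed

section \<open>Diffeological preliminaries\<close>

subsection \<open>Restricting and gluing plots\<close>

text \<open>The axioms of a diffeological space that concern open subsets only: plots can be restricted to
  open subsets and glued along open covers.  Euclidean spaces, subspaces and products satisfy them
  without any chain rule, and they are all that the theory of trivialisations uses.\<close>

locale plot_sheaf =
  fixes X :: "'a diffspace"
  assumes plots_in: "p \<in> plots X n U \<Longrightarrow> openin (Euclidean_space n) U \<and> p \<in> U \<rightarrow>\<^sub>E points X"
    and plots_restrict:
      "\<lbrakk>p \<in> plots X n U; openin (Euclidean_space n) V; V \<subseteq> U\<rbrakk> \<Longrightarrow> restrict p V \<in> plots X n V"
    and plots_glue:
      "\<lbrakk>openin (Euclidean_space n) U; p \<in> U \<rightarrow>\<^sub>E points X; \<Union>\<V> = U;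
        \<And>V. V \<in> \<V> \<Longrightarrow> openin (Euclidean_space n) V \<and> restrict p V \<in> plots X n V\<rbrakk>
       \<Longrightarrow> p \<in> plots X n U"

lemma (in plot_sheaf) plot_points: "p \<in> plots X n U \<Longrightarrow> u \<in> U \<Longrightarrow> p u \<in> points X"
  using plots_in by (blast dest: PiE_mem)

lemma smooth_on_id:
  assumes "openin (Euclidean_space n) U" and "g \<in> U \<rightarrow> Rn n" and "\<And>x. x \<in> U \<Longrightarrow> g x = x"
  shows "smooth_on n U n g"
proof -
  have "Ck_on k n U (\<lambda>x. g x j)" for k j
    using Ck_on_coord[OF assms(1), of k j] assms(3)
    by (subst Ck_on_cong[OF assms(1), where g = "\<lambda>x. x j"]) auto
  with assms(2) show ?thesis by (simp add: smooth_on_def)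
qed

lemma (in diffeological_space) plot_sheaf: "plot_sheaf X"
proof
  fix p n U V
  assume p: "p \<in> plots X n U" and V: "openin (Euclidean_space n) V" "V \<subseteq> U"
  have "compose V p (\<lambda>x. x) \<in> plots X n V"
    using V openin_Euclidean_subset[OF V(1)]
    by (intro plots_compose[OF p] smooth_on_id) auto
  then show "restrict p V \<in> plots X n V"
    by (simp add: compose_def restrict_def)
qed (use plots_wf plots_local in blast)+

lemma points_sub_diff [simp]: "points (sub_diff X A) = points X \<inter> A"
  by (simp add: sub_diff_def)

lemma plots_sub_diff [simp]: "p \<in> plots (sub_diff X A) n U \<longleftrightarrow> p \<in> plots X n U \<and> p ` U \<subseteq> A"
  by (simp add: sub_diff_def)

lemma points_prod_diff [simp]: "points (prod_diff X Y) = points X \<times> points Y"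
  by (simp add: prod_diff_def)

lemma plots_prod_diff [simp]:
  "p \<in> plots (prod_diff X Y) n U \<longleftrightarrow> p \<in> U \<rightarrow>\<^sub>E points X \<times> points Y \<and>
     compose U fst p \<in> plots X n U \<and> compose U snd p \<in> plots Y n U"
  by (simp add: prod_diff_def)

lemma points_Eucl [simp]: "points (Eucl m) = Rn m"
  by (simp add: Eucl_def)

lemma plots_Eucl:
  "p \<in> plots (Eucl m) n U \<longleftrightarrow>
     openin (Euclidean_space n) U \<and> p \<in> U \<rightarrow>\<^sub>E Rn m \<and> (\<forall>j<m. \<forall>k. Ck_on k n U (\<lambda>x. p x j))"
  by (auto simp: Eucl_def smooth_on_def PiE_def)

lemma plot_sheaf_sub:
  assumes "plot_sheaf X"
  shows "plot_sheaf (sub_diff X A)"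
proof -
  interpret plot_sheaf X by fact
  show ?thesis
  proof
    show "openin (Euclidean_space n) U \<and> p \<in> U \<rightarrow>\<^sub>E points (sub_diff X A)"
      if "p \<in> plots (sub_diff X A) n U" for p n U
      using plots_in[of p n U] that by (auto simp: PiE_def)
    show "restrict p V \<in> plots (sub_diff X A) n V"
      if "p \<in> plots (sub_diff X A) n U" "openin (Euclidean_space n) V" "V \<subseteq> U" for p n U V
      using plots_restrict[of p n U V] that by auto
    show "p \<in> plots (sub_diff X A) n U"
      if "openin (Euclidean_space n) U" "p \<in> U \<rightarrow>\<^sub>E points (sub_diff X A)" "\<Union>\<V> = U"
        "\<And>V. V \<in> \<V> \<Longrightarrow> openin (Euclidean_space n) V \<and> restrict p V \<in> plots (sub_diff X A) n V"
      for p n U \<V>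
      using plots_glue[of n U p \<V>] that by (auto simp: PiE_def Pi_def)
  qed
qed

lemma plot_sheaf_prod:
  assumes "plot_sheaf X" and "plot_sheaf Y"
  shows "plot_sheaf (prod_diff X Y)"
proof -
  interpret X: plot_sheaf X by fact
  interpret Y: plot_sheaf Y by fact
  have comp_restrict: "compose V g (restrict p V) = restrict (compose U g p) V"
    if "V \<subseteq> U" for U V and g :: "'x \<Rightarrow> 'y" and p :: "'z \<Rightarrow> 'x"
    using that by (auto simp: compose_def restrict_def fun_eq_iff)
  show ?thesis
  proof
    show "openin (Euclidean_space n) U \<and> p \<in> U \<rightarrow>\<^sub>E points (prod_diff X Y)"
      if "p \<in> plots (prod_diff X Y) n U" for p n U
      using X.plots_in that by auto
    show "restrict p V \<in> plots (prod_diff X Y) n V"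
      if "p \<in> plots (prod_diff X Y) n U" "openin (Euclidean_space n) V" "V \<subseteq> U" for p n U V
      using that X.plots_restrict[of "compose U fst p" n U V] Y.plots_restrict[of "compose U snd p" n U V]
      by (auto simp: comp_restrict PiE_def Pi_def subset_iff)
    show "p \<in> plots (prod_diff X Y) n U"
      if U: "openin (Euclidean_space n) U" and p: "p \<in> U \<rightarrow>\<^sub>E points (prod_diff X Y)"
        and \<V>: "\<Union>\<V> = U"
        and loc: "\<And>V. V \<in> \<V> \<Longrightarrow>
          openin (Euclidean_space n) V \<and> restrict p V \<in> plots (prod_diff X Y) n V"
      for p n U \<V>
    proof -
      have sub: "V \<subseteq> U" if "V \<in> \<V>" for V using that \<V> by blast
      have locX: "openin (Euclidean_space n) V \<and> restrict (compose U fst p) V \<in> plots X n V"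
        and locY: "openin (Euclidean_space n) V \<and> restrict (compose U snd p) V \<in> plots Y n V"
        if "V \<in> \<V>" for V
        using loc[OF that] by (simp_all add: comp_restrict[OF sub[OF that]])
      have "compose U fst p \<in> plots X n U"
        by (rule X.plots_glue[OF U _ \<V> locX]) (use p in \<open>force simp: compose_def dest: PiE_mem\<close>)
      moreover have "compose U snd p \<in> plots Y n U"
        by (rule Y.plots_glue[OF U _ \<V> locY]) (use p in \<open>force simp: compose_def dest: PiE_mem\<close>)
      ultimately show ?thesis
        using p by simp
    qed
  qed
qed

lemma plot_sheaf_Eucl: "plot_sheaf (Eucl m)"
proof
  show "openin (Euclidean_space n) U \<and> p \<in> U \<rightarrow>\<^sub>E points (Eucl m)"
    if "p \<in> plots (Eucl m) n U" for p n U
    using that by (simp add: plots_Eucl)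
  have restr: "Ck_on k n V (\<lambda>x. restrict p V x j) \<longleftrightarrow> Ck_on k n V (\<lambda>x. p x j)"
    if "openin (Euclidean_space n) V" for k n V and p :: "(nat \<Rightarrow> real) \<Rightarrow> nat \<Rightarrow> real" and j
    by (rule Ck_on_cong[OF that]) simp
  show "restrict p V \<in> plots (Eucl m) n V"
    if "p \<in> plots (Eucl m) n U" "openin (Euclidean_space n) V" "V \<subseteq> U" for p n U V
    using that unfolding plots_Eucl restr[OF that(2)]
    by (auto simp: PiE_def Pi_def intro: Ck_on_subset[OF _ that(3)])
  show "p \<in> plots (Eucl m) n U"
    if "openin (Euclidean_space n) U" "p \<in> U \<rightarrow>\<^sub>E points (Eucl m)" "\<Union>\<V> = U"
      and loc: "\<And>V. V \<in> \<V> \<Longrightarrow> openin (Euclidean_space n) V \<and> restrict p V \<in> plots (Eucl m) n V"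
    for p n U \<V>
  proof -
    have "Ck_on k n U (\<lambda>x. p x j)" if "j < m" for j k
      unfolding \<open>\<Union>\<V> = U\<close>[symmetric]
    proof (rule Ck_on_Union)
      fix V assume "V \<in> \<V>"
      then have V: "openin (Euclidean_space n) V" "restrict p V \<in> plots (Eucl m) n V"
        using loc by blast+
      show "openin (Euclidean_space n) V" by fact
      show "Ck_on k n V (\<lambda>x. p x j)"
        using V(2) \<open>j < m\<close> unfolding plots_Eucl restr[OF V(1)] by blast
    qed
    with that(1,2) show ?thesis by (simp add: plots_Eucl)
  qed
qed

lemma sub_diff_superset:
  assumes "plot_sheaf X" and "points X \<subseteq> A"
  shows "sub_diff X A = X"
proof -
  have "p u \<in> A" if "p \<in> plots X n U" "u \<in> U" for p n U u
    using plot_sheaf.plot_points[OF assms(1) that] assms(2) by blast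
  with assms(2) show ?thesis
    by (intro diffspace.equality) (auto simp: sub_diff_def fun_eq_iff)
qed

lemma sub_diff_Eucl_Rn: "sub_diff (Eucl n) (Rn n) = Eucl n"
  by (rule sub_diff_superset[OF plot_sheaf_Eucl]) simp

subsection \<open>Smooth maps\<close>

lemma smooth_map_points: "smooth_map X Y f \<Longrightarrow> x \<in> points X \<Longrightarrow> f x \<in> points Y"
  by (auto simp: smooth_map_def)

lemma smooth_map_compose:
  "smooth_map X Y f \<Longrightarrow> smooth_map Y Z g \<Longrightarrow> smooth_map X Z (\<lambda>x. g (f x))"
proof -
  assume f: "smooth_map X Y f" and g: "smooth_map Y Z g"
  have "compose U (\<lambda>x. g (f x)) p = compose U g (compose U f p)" for U and p :: "(nat \<Rightarrow> real) \<Rightarrow> 'a"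
    by (auto simp: compose_def restrict_def)
  with f g show ?thesis by (auto simp: smooth_map_def)
qed

lemma smooth_map_cong:
  assumes "plot_sheaf X" and "smooth_map X Y f" and eq: "\<And>x. x \<in> points X \<Longrightarrow> f x = g x"
  shows "smooth_map X Y g"
proof -
  have "compose U g p = compose U f p" if "p \<in> plots X n U" for n U p
    using plot_sheaf.plot_points[OF assms(1) that] by (auto simp: compose_def restrict_def eq fun_eq_iff)
  with assms(2) eq show ?thesis by (auto simp: smooth_map_def Pi_def)
qed

lemma smooth_map_from_sub: "smooth_map X Y f \<Longrightarrow> smooth_map (sub_diff X A) Y f"
  by (auto simp: smooth_map_def)

lemma smooth_map_into_sub:
  assumes "plot_sheaf X" "smooth_map X Y f" and "\<And>x. x \<in> points X \<Longrightarrow> f x \<in> A"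
  shows "smooth_map X (sub_diff Y A) f"
  using assms(2,3) plot_sheaf.plot_points[OF assms(1)] by (fastforce simp: smooth_map_def compose_def)

lemma smooth_map_of_sub: "smooth_map X (sub_diff Y A) f \<Longrightarrow> smooth_map X Y f"
  by (auto simp: smooth_map_def)

lemma smooth_map_subset:
  "smooth_map (sub_diff X A) Y f \<Longrightarrow> B \<subseteq> A \<Longrightarrow> smooth_map (sub_diff X B) Y f"
  by (auto simp: smooth_map_def subset_iff Pi_def)

lemma smooth_map_Pair:
  assumes "plot_sheaf X" "smooth_map X Y f" "smooth_map X Z g"
  shows "smooth_map X (prod_diff Y Z) (\<lambda>x. (f x, g x))"
proof -
  have "compose U fst (compose U (\<lambda>x. (f x, g x)) p) = compose U f p"
    "compose U snd (compose U (\<lambda>x. (f x, g x)) p) = compose U g p" 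
    for U and p :: "(nat \<Rightarrow> real) \<Rightarrow> 'a"
    by (auto simp: compose_def restrict_def)
  moreover have "compose U (\<lambda>x. (f x, g x)) p \<in> U \<rightarrow>\<^sub>E points Y \<times> points Z"
    if "p \<in> plots X n U" for n U p
    using plot_sheaf.plots_in[OF assms(1) that] assms(2,3) by (auto simp: compose_def smooth_map_def)
  ultimately show ?thesis
    using assms(2,3) by (auto simp: smooth_map_def)
qed

lemma smooth_map_fst: "smooth_map (prod_diff X Y) X fst"
  and smooth_map_snd: "smooth_map (prod_diff X Y) Y snd"
  by (auto simp: smooth_map_def)

text \<open>Smoothness is local over a Euclidean base: plots of \<open>X\<close> are cut into pieces by pulling back an
  open cover of $R^n$ along the smooth map \<open>q\<close>.\<close>

lemma smooth_map_locally:
  assumes X: "plot_sheaf X" and Z: "plot_sheaf Z" and q: "smooth_map X (Eucl n) q"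
    and open_I: "\<And>i. i \<in> I \<Longrightarrow> openin (Euclidean_space n) (U i)"
    and cover: "\<And>x. x \<in> points X \<Longrightarrow> \<exists>i\<in>I. q x \<in> U i"
    and f: "\<And>i. i \<in> I \<Longrightarrow> smooth_map (sub_diff X (q -` U i)) Z f"
  shows "smooth_map X Z f"
proof -
  have "compose V f p \<in> plots Z m V" if p: "p \<in> plots X m V" for m V p
  proof -
    have V: "openin (Euclidean_space m) V" and pV: "p \<in> V \<rightarrow>\<^sub>E points X"
      using plot_sheaf.plots_in[OF X p] by auto
    have qp: "compose V q p \<in> plots (Eucl n) m V"
      using q p by (auto simp: smooth_map_def)
    define W where "W i = {v \<in> V. q (p v) \<in> U i}" for i
    have W: "openin (Euclidean_space m) (W i)" if "i \<in> I" for i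
    proof -
      have "continuous_map (subtopology (Euclidean_space m) V) (Euclidean_space n) (compose V q p)"
        unfolding Euclidean_space_eq
      proof (simp add: subtopology_subtopology, intro conjI)
        have sub: "V \<subseteq> Rn m" by (rule openin_Euclidean_subset[OF V])
        show "continuous_on (Rn m \<inter> V) (compose V q p)"
        proof (rule continuous_on_coordinatewise_then_product)
          fix j
          show "continuous_on (Rn m \<inter> V) (\<lambda>x. compose V q p x j)"
          proof (cases "j < n")
            case True
            then have "Ck_on 0 m V (\<lambda>x. compose V q p x j)"
              using qp by (simp only: plots_Eucl)
            then have "continuous_on V (\<lambda>x. compose V q p x j)"
              using sub by (rule Ck_on_continuous)
            then show ?thesis by (rule continuous_on_subset) simp
          next
            case False
            have "compose V q p x j = 0" if "x \<in> Rn m \<inter> V" for x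
              using that False qp by (auto simp: plots_Eucl Rn_iff PiE_def Pi_def)
            then show ?thesis
              by (intro continuous_on_eq[OF continuous_on_const[of _ 0]]) simp
          qed
        qed
        show "compose V q p \<in> Rn m \<inter> V \<rightarrow> Rn n"
          using qp by (auto simp: plots_Eucl)
      qed
      then have "openin (subtopology (Euclidean_space m) V)
          {v \<in> topspace (subtopology (Euclidean_space m) V). compose V q p v \<in> U i}"
        using open_I[OF that] by (rule openin_continuous_map_preimage)
      moreover have "{v \<in> topspace (subtopology (Euclidean_space m) V). compose V q p v \<in> U i} = W i"
        using openin_Euclidean_subset[OF V] by (auto simp: W_def compose_def)
      ultimately show ?thesis
        using V by (metis openin_trans_full)
    qed
    show ?thesis
    proof (rule plot_sheaf.plots_glue[OF Z V])
      have "f x \<in> points Z" if "x \<in> points X" for x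
        using cover[OF that] f that by (auto simp: smooth_map_def)
      then show "compose V f p \<in> V \<rightarrow>\<^sub>E points Z"
        using pV by (auto simp: compose_def)
      show "\<Union>(W ` I) = V"
        using cover pV by (auto simp: W_def)
      show "openin (Euclidean_space m) V' \<and> restrict (compose V f p) V' \<in> plots Z m V'"
        if V': "V' \<in> W ` I" for V'
      proof -
        obtain i where i: "i \<in> I" "V' = W i" using V' by blast
        have "W i \<subseteq> V" by (auto simp: W_def)
        have "restrict p (W i) \<in> plots (sub_diff X (q -` U i)) m (W i)"
          using plot_sheaf.plots_restrict[OF X p W[OF i(1)] \<open>W i \<subseteq> V\<close>] by (auto simp: W_def)
        then have "compose (W i) f (restrict p (W i)) \<in> plots Z m (W i)"
          using f[OF i(1)] by (auto simp: smooth_map_def)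
        moreover have "compose (W i) f (restrict p (W i)) = restrict (compose V f p) (W i)"
          using \<open>W i \<subseteq> V\<close> by (auto simp: compose_def restrict_def fun_eq_iff)
        ultimately show ?thesis
          using W i by simp
      qed
    qed
  qed
  moreover have "f x \<in> points Z" if "x \<in> points X" for x
    using cover[OF that] f that by (auto simp: smooth_map_def)
  ultimately show ?thesis
    by (auto simp: smooth_map_def)
qed

lemma smooth_map_EuclI:
  assumes "plot_sheaf X"
    and "\<And>x. x \<in> points X \<Longrightarrow> f x \<in> Rn m"
    and "\<And>n U p j k. p \<in> plots X n U \<Longrightarrow> openin (Euclidean_space n) U \<Longrightarrow> j < m \<Longrightarrow>
      Ck_on k n U (\<lambda>u. f (p u) j)"
  shows "smooth_map X (Eucl m) f"
proof -
  have "Ck_on k n U (\<lambda>u. compose U f p u j)" if "p \<in> plots X n U" "j < m" for n U p j k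
    using assms(3)[OF that(1) _ that(2)] plot_sheaf.plots_in[OF assms(1) that(1)]
    by (subst Ck_on_cong[where g = "\<lambda>u. f (p u) j"]) (auto simp: compose_def)
  moreover have "compose U f p \<in> U \<rightarrow>\<^sub>E Rn m" if "p \<in> plots X n U" for n U p
    using plot_sheaf.plots_in[OF assms(1) that] assms(2) by (auto simp: compose_def)
  ultimately show ?thesis
    using assms(2) plot_sheaf.plots_in[OF assms(1)] by (auto simp: smooth_map_def plots_Eucl)
qed

lemma openin_Rn [simp]: "openin (Euclidean_space n) (Rn n)"
  using openin_topspace[of "Euclidean_space n"] by simp

lemma id_plot_Eucl: "restrict (\<lambda>x. x) (Rn n) \<in> plots (Eucl n) n (Rn n)"
  using smooth_on_id[OF openin_Rn[of n], of "restrict (\<lambda>x. x) (Rn n)"] by (auto simp: Eucl_def)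

section \<open>Trivialisations over open subsets of a Euclidean space\<close>

text \<open>A trivialisation over the open set \<open>U\<close> of a map \<open>q\<close> from \<open>T\<close> to $R^n$.  The diffeomorphism from
  the part of \<open>T\<close> over \<open>U\<close> to the product of \<open>F\<close> and \<open>U\<close> has second component \<open>q\<close>, so only its first
  component \<open>\<phi>\<close> is recorded, together with the inverse diffeomorphism \<open>\<psi>\<close>.\<close>

definition chart :: "nat \<Rightarrow> 'c diffspace \<Rightarrow> 'e diffspace \<Rightarrow> ('e \<Rightarrow> nat \<Rightarrow> real) \<Rightarrow> (nat \<Rightarrow> real) set \<Rightarrow>
    ('e \<Rightarrow> 'c) \<Rightarrow> ('c \<times> (nat \<Rightarrow> real) \<Rightarrow> 'e) \<Rightarrow> bool" where
  "chart n F T q U \<phi> \<psi> \<longleftrightarrow> openin (Euclidean_space n) U \<and>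
     smooth_map (sub_diff T (q -` U)) F \<phi> \<and>
     smooth_map (prod_diff F (sub_diff (Eucl n) U)) T \<psi> \<and>
     (\<forall>v\<in>points F. \<forall>u\<in>U. q (\<psi> (v, u)) = u \<and> \<phi> (\<psi> (v, u)) = v) \<and>
     (\<forall>e\<in>points T. q e \<in> U \<longrightarrow> \<psi> (\<phi> e, q e) = e)"

text \<open>The map \<open>q\<close> is trivial of fibre type \<open>F\<close> over the open set \<open>U\<close>.\<close>

definition trivial_over :: "nat \<Rightarrow> 'c diffspace \<Rightarrow> 'e diffspace \<Rightarrow> ('e \<Rightarrow> nat \<Rightarrow> real) \<Rightarrow>
    (nat \<Rightarrow> real) set \<Rightarrow> bool" where
  "trivial_over n F T q U \<longleftrightarrow> (\<exists>\<phi> \<psi>. chart n F T q U \<phi> \<psi>)"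

lemma chartD:
  assumes "chart n F T q U \<phi> \<psi>"
  shows chart_open: "openin (Euclidean_space n) U"
    and chart_subset: "U \<subseteq> Rn n"
    and chart_smooth: "smooth_map (sub_diff T (q -` U)) F \<phi>"
    and chart_inv_smooth: "smooth_map (prod_diff F (sub_diff (Eucl n) U)) T \<psi>"
    and chart_points: "e \<in> points T \<Longrightarrow> q e \<in> U \<Longrightarrow> \<phi> e \<in> points F"
    and chart_inv_points: "v \<in> points F \<Longrightarrow> u \<in> U \<Longrightarrow> \<psi> (v, u) \<in> points T"
    and chart_base: "v \<in> points F \<Longrightarrow> u \<in> U \<Longrightarrow> q (\<psi> (v, u)) = u"
    and chart_inv: "v \<in> points F \<Longrightarrow> u \<in> U \<Longrightarrow> \<phi> (\<psi> (v, u)) = v"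
    and inv_chart: "e \<in> points T \<Longrightarrow> q e \<in> U \<Longrightarrow> \<psi> (\<phi> e, q e) = e"
proof -
  show U: "openin (Euclidean_space n) U" and phi: "smooth_map (sub_diff T (q -` U)) F \<phi>"
    and psi: "smooth_map (prod_diff F (sub_diff (Eucl n) U)) T \<psi>"
    using assms by (auto simp: chart_def)
  show sub: "U \<subseteq> Rn n" by (rule openin_Euclidean_subset[OF U])
  show "e \<in> points T \<Longrightarrow> q e \<in> U \<Longrightarrow> \<phi> e \<in> points F"
    using smooth_map_points[OF phi] by simp
  show "v \<in> points F \<Longrightarrow> u \<in> U \<Longrightarrow> \<psi> (v, u) \<in> points T"
    using smooth_map_points[OF psi] sub by auto
qed (use assms in \<open>auto simp: chart_def\<close>)

lemma smooth_map_sub_mono_prod: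
  assumes "smooth_map (prod_diff F (sub_diff X A)) Y f" and "B \<subseteq> A"
  shows "smooth_map (prod_diff F (sub_diff X B)) Y f"
proof -
  have "p \<in> plots (prod_diff F (sub_diff X A)) n U" if "p \<in> plots (prod_diff F (sub_diff X B)) n U" for p n U
  proof -
    have "U \<rightarrow>\<^sub>E points F \<times> (points X \<inter> B) \<subseteq> U \<rightarrow>\<^sub>E points F \<times> (points X \<inter> A)"
      using assms(2) by (intro PiE_mono) blast
    with that assms(2) show ?thesis
      unfolding plots_prod_diff plots_sub_diff points_sub_diff by blast
  qed
  with assms show ?thesis by (auto simp: smooth_map_def)
qed

text \<open>A smooth map to $R^n$, seen as a family of spaces over $R^n$, and a prospective fibre.\<close>

locale Euclidean_family =
  fixes n :: nat and F :: "'c diffspace" and T :: "'e diffspace" and q :: "'e \<Rightarrow> nat \<Rightarrow> real"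
  assumes F: "plot_sheaf F" and T: "plot_sheaf T" and q: "smooth_map T (Eucl n) q"
begin

abbreviation is_chart where "is_chart \<equiv> chart n F T q"

abbreviation is_trivial_over where "is_trivial_over \<equiv> trivial_over n F T q"

lemma sheaf_total: "plot_sheaf (sub_diff T A)"
  by (rule plot_sheaf_sub[OF T])

lemma sheaf_product: "plot_sheaf (prod_diff F (sub_diff (Eucl n) U))"
  by (intro plot_sheaf_prod plot_sheaf_sub plot_sheaf_Eucl F)

lemma base_points: "e \<in> points T \<Longrightarrow> q e \<in> Rn n"
  using smooth_map_points[OF q] by simp

lemma chart_restrict:
  assumes "is_chart U \<phi> \<psi>" and "openin (Euclidean_space n) V" and "V \<subseteq> U"
  shows "is_chart V \<phi> \<psi>"
proof -
  have "smooth_map (sub_diff T (q -` V)) F \<phi>"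
    using chart_smooth[OF assms(1)] by (rule smooth_map_subset) (use assms(3) in blast)
  moreover have "smooth_map (prod_diff F (sub_diff (Eucl n) V)) T \<psi>"
    using chart_inv_smooth[OF assms(1)] assms(3) by (rule smooth_map_sub_mono_prod)
  ultimately show ?thesis
    using assms by (auto simp: chart_def subset_iff)
qed

lemma trivial_over_subset:
  "is_trivial_over U \<Longrightarrow> openin (Euclidean_space n) V \<Longrightarrow> V \<subseteq> U \<Longrightarrow> is_trivial_over V"
  unfolding trivial_over_def using chart_restrict by blast

text \<open>The gluing device.  Over \<open>B\<close>, the given trivialisation identifies the fibre over \<open>u\<close> with the
  fibre over \<open>\<rho> u\<close>, where the trivialisation over \<open>A\<close> is available; following this identification by
  the latter trivialisation gives a new one, which agrees with the one over \<open>A\<close> at every fixed point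
  of \<open>\<rho>\<close>.\<close>

lemma chart_modify:
  assumes A: "is_chart A \<phi> \<psi>" and B: "is_chart B \<phi>' \<psi>'"
    and \<rho>: "smooth_map (sub_diff (Eucl n) B) (Eucl n) \<rho>"
    and \<rho>_mem: "\<And>u. u \<in> B \<Longrightarrow> \<rho> u \<in> A \<inter> B"
  obtains \<phi>'' \<psi>'' where "is_chart B \<phi>'' \<psi>''"
    and "\<And>e. e \<in> points T \<Longrightarrow> q e \<in> B \<Longrightarrow> \<rho> (q e) = q e \<Longrightarrow> \<phi>'' e = \<phi> e"
proof
  note Ad = chartD[OF A] and Bd = chartD[OF B]
  define \<phi>'' where "\<phi>'' e = \<phi> (\<psi>' (\<phi>' e, \<rho> (q e)))" for e
  define \<psi>'' where "\<psi>'' z = \<psi>' (\<phi>' (\<psi> (fst z, \<rho> (snd z))), snd z)" for z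
  have \<rho>_mem': "\<rho> u \<in> A" "\<rho> u \<in> B" if "u \<in> B" for u
    using \<rho>_mem[OF that] by auto
  show "is_chart B \<phi>'' \<psi>''"
    unfolding chart_def
  proof (intro conjI ballI impI)
    let ?S = "sub_diff T (q -` B)" and ?P = "prod_diff F (sub_diff (Eucl n) B)"
    have "smooth_map ?S (sub_diff (Eucl n) B) q"
      by (rule smooth_map_into_sub[OF sheaf_total smooth_map_from_sub[OF q]]) auto
    then have "smooth_map ?S (Eucl n) (\<lambda>e. \<rho> (q e))"
      using \<rho> by (rule smooth_map_compose)
    then have "smooth_map ?S (sub_diff (Eucl n) B) (\<lambda>e. \<rho> (q e))"
      by (rule smooth_map_into_sub[OF sheaf_total]) (use \<rho>_mem' in auto)
    from smooth_map_Pair[OF sheaf_total Bd(3) this]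
    have "smooth_map ?S T (\<lambda>e. \<psi>' (\<phi>' e, \<rho> (q e)))"
      using Bd(4) by (rule smooth_map_compose)
    then have "smooth_map ?S (sub_diff T (q -` A)) (\<lambda>e. \<psi>' (\<phi>' e, \<rho> (q e)))"
      by (rule smooth_map_into_sub[OF sheaf_total]) (use \<rho>_mem' Bd in auto)
    then show "smooth_map ?S F \<phi>''"
      unfolding \<phi>''_def using Ad(3) by (rule smooth_map_compose)
    have "smooth_map ?P (Eucl n) (\<lambda>z. \<rho> (snd z))"
      using smooth_map_snd \<rho> by (rule smooth_map_compose)
    then have "smooth_map ?P (sub_diff (Eucl n) A) (\<lambda>z. \<rho> (snd z))"
      by (rule smooth_map_into_sub[OF sheaf_product]) (use \<rho>_mem' in auto)
    from smooth_map_Pair[OF sheaf_product smooth_map_fst this]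
    have "smooth_map ?P T (\<lambda>z. \<psi> (fst z, \<rho> (snd z)))"
      using Ad(4) by (rule smooth_map_compose)
    then have "smooth_map ?P (sub_diff T (q -` B)) (\<lambda>z. \<psi> (fst z, \<rho> (snd z)))"
      by (rule smooth_map_into_sub[OF sheaf_product]) (use \<rho>_mem' Ad in auto)
    then have "smooth_map ?P F (\<lambda>z. \<phi>' (\<psi> (fst z, \<rho> (snd z))))"
      using Bd(3) by (rule smooth_map_compose)
    from smooth_map_Pair[OF sheaf_product this smooth_map_snd]
    show "smooth_map ?P T \<psi>''"
      unfolding \<psi>''_def using Bd(4) by (rule smooth_map_compose)
    show "openin (Euclidean_space n) B" by (rule Bd(1))
  next
    fix v u assume v: "v \<in> points F" and u: "u \<in> B"
    have w: "\<phi>' (\<psi> (v, \<rho> u)) \<in> points F"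
      using v u \<rho>_mem' by (intro Bd(5) Ad(6)) (auto simp: Ad(7))
    then show "q (\<psi>'' (v, u)) = u"
      using u by (simp add: \<psi>''_def Bd(7))
    have "\<psi>' (\<phi>' (\<psi> (v, \<rho> u)), \<rho> u) = \<psi> (v, \<rho> u)"
      using Bd(9)[of "\<psi> (v, \<rho> u)"] v u \<rho>_mem' by (simp add: Ad(6,7))
    with w u v \<rho>_mem' show "\<phi>'' (\<psi>'' (v, u)) = v"
      by (simp add: \<phi>''_def \<psi>''_def Bd(7,8) Ad(8))
  next
    fix e assume e: "e \<in> points T" "q e \<in> B"
    have w: "\<phi>' e \<in> points F" using e by (rule Bd(5))
    then have "\<psi> (\<phi> (\<psi>' (\<phi>' e, \<rho> (q e))), \<rho> (q e)) = \<psi>' (\<phi>' e, \<rho> (q e))"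
      using Ad(9)[of "\<psi>' (\<phi>' e, \<rho> (q e))"] e \<rho>_mem' by (simp add: Bd(6,7))
    then show "\<psi>'' (\<phi>'' e, q e) = e"
      using e w \<rho>_mem' by (simp add: \<phi>''_def \<psi>''_def Bd(8,9))
  qed
  show "\<phi>'' e = \<phi> e" if "e \<in> points T" "q e \<in> B" "\<rho> (q e) = q e" for e
    using that by (simp add: \<phi>''_def Bd(9))
qed

text \<open>The fibre components determine the inverses, so agreement of the former suffices for gluing.\<close>

lemma chart_glue:
  assumes charts: "\<And>i. i \<in> I \<Longrightarrow> is_chart (U i) (\<phi> i) (\<psi> i)"
    and agree: "\<And>i j e. i \<in> I \<Longrightarrow> j \<in> I \<Longrightarrow> e \<in> points T \<Longrightarrow> q e \<in> U i \<Longrightarrow> q e \<in> U j \<Longrightarrow> \<phi> i e = \<phi> j e"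
  shows "is_trivial_over (\<Union>i\<in>I. U i)"
proof -
  let ?U = "\<Union>i\<in>I. U i"
  define c where "c u = (SOME i. i \<in> I \<and> u \<in> U i)" for u
  have c: "c u \<in> I" "u \<in> U (c u)" if "u \<in> ?U" for u
    using someI_ex[of "\<lambda>i. i \<in> I \<and> u \<in> U i"] that by (auto simp: c_def)
  define \<phi>0 where "\<phi>0 e = \<phi> (c (q e)) e" for e
  define \<psi>0 where "\<psi>0 z = \<psi> (c (snd z)) z" for z
  have \<phi>0: "\<phi>0 e = \<phi> i e" if "i \<in> I" "e \<in> points T" "q e \<in> U i" for i e
    using agree[of "c (q e)" i e] c[of "q e"] that by (auto simp: \<phi>0_def)
  have \<psi>0: "\<psi>0 (v, u) = \<psi> i (v, u)" if "i \<in> I" "v \<in> points F" "u \<in> U i" for i v u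
  proof -
    have u: "c u \<in> I" "u \<in> U (c u)" using c[of u] that by auto
    note cd = chartD[OF charts[OF u(1)]] and id = chartD[OF charts[OF that(1)]]
    let ?e = "\<psi> (c u) (v, u)"
    have e: "?e \<in> points T" "q ?e = u" using that(2) u(2) by (simp_all add: cd(6,7))
    have "\<phi> i ?e = \<phi> (c u) ?e"
      using e u that by (intro agree) auto
    then have "\<phi> i ?e = v" using that(2) u(2) by (simp add: cd(8))
    then show ?thesis
      using id(9)[of ?e] e that by (simp add: \<psi>0_def)
  qed
  have "is_chart ?U \<phi>0 \<psi>0"
    unfolding chart_def
  proof (intro conjI ballI impI)
    show "openin (Euclidean_space n) ?U"
      using charts by (intro openin_Union) (auto intro: chart_open)
    show "smooth_map (sub_diff T (q -` ?U)) F \<phi>0"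
    proof (rule smooth_map_locally[OF sheaf_total F smooth_map_from_sub[OF q]])
      show "smooth_map (sub_diff (sub_diff T (q -` ?U)) (q -` U i)) F \<phi>0" if "i \<in> I" for i
      proof (rule smooth_map_cong[OF plot_sheaf_sub[OF sheaf_total]])
        have "sub_diff (sub_diff T (q -` ?U)) (q -` U i) = sub_diff T (q -` U i)"
          using that by (auto simp: sub_diff_def fun_eq_iff)
        then show "smooth_map (sub_diff (sub_diff T (q -` ?U)) (q -` U i)) F (\<phi> i)"
          using chart_smooth[OF charts[OF that]] by simp
      qed (use \<phi>0 that in auto)
    qed (use charts in \<open>auto intro: chart_open\<close>)
    show "smooth_map (prod_diff F (sub_diff (Eucl n) ?U)) T \<psi>0"
    proof (rule smooth_map_locally[OF sheaf_product T smooth_map_of_sub[OF smooth_map_snd]])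
      show "smooth_map (sub_diff (prod_diff F (sub_diff (Eucl n) ?U)) (snd -` U i)) T \<psi>0"
        if "i \<in> I" for i
      proof (rule smooth_map_cong[OF plot_sheaf_sub[OF sheaf_product]])
        have "smooth_map (sub_diff (prod_diff F (sub_diff (Eucl n) ?U)) (snd -` U i))
          (prod_diff F (sub_diff (Eucl n) (U i))) (\<lambda>z. (fst z, snd z))"
          by (intro smooth_map_Pair smooth_map_into_sub smooth_map_from_sub
              smooth_map_of_sub[OF smooth_map_snd] smooth_map_fst plot_sheaf_sub sheaf_product) auto
        from smooth_map_compose[OF this chart_inv_smooth[OF charts[OF that]]]
        show "smooth_map (sub_diff (prod_diff F (sub_diff (Eucl n) ?U)) (snd -` U i)) T (\<psi> i)"
          by simp
      qed (use \<psi>0 that in auto)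
    qed (use charts in \<open>auto intro: chart_open\<close>)
  next
    fix v u assume v: "v \<in> points F" and "u \<in> ?U"
    then obtain i where i: "i \<in> I" "u \<in> U i" by blast
    note id = chartD[OF charts[OF i(1)]]
    show "q (\<psi>0 (v, u)) = u" "\<phi>0 (\<psi>0 (v, u)) = v"
      using \<psi>0[OF i(1) v i(2)] \<phi>0[OF i(1), of "\<psi> i (v, u)"] v i by (simp_all add: id(6-8))
  next
    fix e assume e: "e \<in> points T" and "q e \<in> ?U"
    then obtain i where i: "i \<in> I" "q e \<in> U i" by blast
    note id = chartD[OF charts[OF i(1)]]
    show "\<psi>0 (\<phi>0 e, q e) = e"
      using \<phi>0[OF i(1) e i(2)] \<psi>0[OF i(1) _ i(2), of "\<phi>0 e"] id(5,9)[OF e i(2)] by simp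
  qed
  then show ?thesis by (auto simp: trivial_over_def)
qed

end

section \<open>Bundles over a Euclidean space are trivial\<close>

text \<open>The open box with sides from \<open>c i\<close> to \<open>d i\<close>; the values at \<open>i \<ge> n\<close> are irrelevant.\<close>

definition box_Rn :: "nat \<Rightarrow> (nat \<Rightarrow> real) \<Rightarrow> (nat \<Rightarrow> real) \<Rightarrow> (nat \<Rightarrow> real) set" where
  "box_Rn n c d = {x \<in> Rn n. \<forall>i<n. c i < x i \<and> x i < d i}"

lemma open_box_Rn: "openin (Euclidean_space n) (box_Rn n c d)"
proof -
  have "open {x :: nat \<Rightarrow> real. c i < x i \<and> x i < d i}" for i
  proof -
    have "{x :: nat \<Rightarrow> real. c i < x i \<and> x i < d i} = (\<lambda>x. x i) -` {c i<..<d i}" by auto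
    then show ?thesis
      using open_vimage[OF open_greaterThanLessThan continuous_on_product_coordinates] by metis
  qed
  then have "open (\<Inter>i\<in>{..<n}. {x. c i < x i \<and> x i < d i})"
    by (intro open_INT) auto
  moreover have "box_Rn n c d = Rn n \<inter> (\<Inter>i\<in>{..<n}. {x. c i < x i \<and> x i < d i})"
    by (auto simp: box_Rn_def)
  ultimately show ?thesis
    unfolding Euclidean_space_eq openin_open by blast
qed

lemma box_Rn_nhds:
  assumes "openin (Euclidean_space n) U" and x: "x \<in> U"
  obtains c d where "\<And>i. c i < x i \<and> x i < d i" and "box_Rn n c d \<subseteq> U"
proof -
  obtain W where W: "open W" "U = Rn n \<inter> W"
    using assms(1) unfolding Euclidean_space_eq openin_open by auto
  then have "openin (product_topology (\<lambda>i. euclidean) UNIV) W"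
    by (simp add: euclidean_product_topology)
  then obtain Y where Y: "x \<in> Pi\<^sub>E UNIV Y" "\<And>i. open (Y i)" "Pi\<^sub>E UNIV Y \<subseteq> W"
    using product_topology_open_contains_basis[of "\<lambda>i. euclidean" UNIV W x] x W(2) by auto
  have "\<exists>c d. c < x i \<and> x i < d \<and> {c<..<d} \<subseteq> Y i" for i
  proof -
    have "x i \<in> Y i" using Y(1) by auto
    then obtain e where "e > 0" "ball (x i) e \<subseteq> Y i"
      using Y(2) open_contains_ball by metis
    then show ?thesis
      by (intro exI[of _ "x i - e"] exI[of _ "x i + e"]) (auto simp: ball_def dist_real_def abs_less_iff subset_iff)
  qed
  then obtain c d where cd: "\<And>i. c i < x i \<and> x i < d i \<and> {c i<..<d i} \<subseteq> Y i"
    by metis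
  show thesis
  proof
    show "c i < x i \<and> x i < d i" for i using cd by blast
    show "box_Rn n c d \<subseteq> U"
    proof
      fix y assume y: "y \<in> box_Rn n c d"
      have "y i \<in> Y i" for i
      proof (cases "i < n")
        case True
        with y have "y i \<in> {c i<..<d i}" by (simp add: box_Rn_def)
        with cd[of i] show ?thesis by blast
      next
        case False
        then have "y i = x i" using x y W(2) by (simp add: box_Rn_def Rn_iff)
        moreover have "x i \<in> {c i<..<d i}" using cd[of i] by simp
        ultimately show ?thesis using cd[of i] by auto
      qed
      with Y(3) have "y \<in> W" by auto
      with y W(2) show "y \<in> U" by (simp add: box_Rn_def)
    qed
  qed
qed

lemma smooth_map_coordinatewise:
  assumes r: "\<And>i. i < n \<Longrightarrow> smooth_fun (r i)"
  shows "smooth_map (sub_diff (Eucl n) B) (Eucl n) (\<lambda>x i. if i < n then r i (x i) else 0)"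
proof (rule smooth_map_EuclI)
  show "plot_sheaf (sub_diff (Eucl n) B)"
    by (rule plot_sheaf_sub[OF plot_sheaf_Eucl])
  show "(\<lambda>i. if i < n then r i (x i) else 0) \<in> Rn n" for x
    by (simp add: Rn_iff)
  show "Ck_on k m U (\<lambda>u. if j < n then r j (p u j) else 0)"
    if "p \<in> plots (sub_diff (Eucl n) B) m U" "openin (Euclidean_space m) U" "j < n" for m U p j k
    using that r[OF that(3)] by (simp add: smooth_fun_def plots_Eucl)
qed

context Euclidean_family
begin

text \<open>The two boxes have the same sides except in direction \<open>j\<close>, where they are the intervals from \<open>l'\<close>
  to \<open>h\<close> and from \<open>l\<close> to \<open>h'\<close>, which overlap in the interval from \<open>l\<close> to \<open>h\<close>.  The trivialisation over
  the second box is modified so that it agrees with the first one below the midpoint of the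
  overlap.\<close>

lemma trivial_over_join_boxes:
  assumes A: "is_trivial_over (box_Rn n (C(j := l')) (D(j := h)))"
    and B: "is_trivial_over (box_Rn n (C(j := l)) (D(j := h')))"
    and j: "j < n" and order: "l' \<le> l" "l < h" "h \<le> h'"
  shows "is_trivial_over (box_Rn n (C(j := l')) (D(j := h')))"
proof -
  let ?A = "box_Rn n (C(j := l')) (D(j := h))" and ?B = "box_Rn n (C(j := l)) (D(j := h'))"
  define m where "m = (l + h) / 2"
  have m: "l < m" "m < h" using order by (auto simp: m_def)
  obtain \<phi> \<psi> where A: "is_chart ?A \<phi> \<psi>" using A by (auto simp: trivial_over_def)
  obtain \<phi>' \<psi>' where B: "is_chart ?B \<phi>' \<psi>'" using B by (auto simp: trivial_over_def)
  obtain r where r: "smooth_fun r" "\<And>t. t \<le> m \<Longrightarrow> r t = t" "\<And>t. m < t \<Longrightarrow> m \<le> r t \<and> r t < h"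
    using smooth_cutoff_above[OF m(2)] by blast
  define \<rho> where "\<rho> x = (\<lambda>i. if i < n then (if i = j then r else (\<lambda>t. t)) (x i) else 0)"
    for x :: "nat \<Rightarrow> real"
  have \<rho>_smooth: "smooth_map (sub_diff (Eucl n) ?B) (Eucl n) \<rho>"
    unfolding \<rho>_def by (rule smooth_map_coordinatewise) (simp add: r(1) smooth_fun_id)
  have \<rho>_mem: "\<rho> u \<in> ?A \<inter> ?B" if u: "u \<in> ?B" for u
  proof -
    have "l < u j" using u j by (auto simp: box_Rn_def)
    then have rj: "l < r (u j)" "r (u j) < h" using m r(2,3)[of "u j"] by fastforce+
    have "\<rho> u \<in> Rn n" by (simp add: \<rho>_def Rn_iff)
    moreover have "(C(j := x)) i < \<rho> u i \<and> \<rho> u i < (D(j := y)) i"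
      if "x \<le> l" "h \<le> y" "i < n" for x y i
      using u rj that by (auto simp: \<rho>_def box_Rn_def)
    ultimately show ?thesis using order by (auto simp: box_Rn_def)
  qed
  have \<rho>_id: "\<rho> u = u" if "u \<in> Rn n" "u j < m" for u
    using that r(2)[of "u j"] by (auto simp: \<rho>_def Rn_iff fun_eq_iff)
  obtain \<phi>'' \<psi>'' where B': "is_chart ?B \<phi>'' \<psi>''"
    and eq: "\<And>e. e \<in> points T \<Longrightarrow> q e \<in> ?B \<Longrightarrow> \<rho> (q e) = q e \<Longrightarrow> \<phi>'' e = \<phi> e"
    using chart_modify[OF A B \<rho>_smooth \<rho>_mem] by blast
  let ?A' = "box_Rn n (C(j := l')) (D(j := m))"
  have "is_chart ?A' \<phi> \<psi>"
    by (rule chart_restrict[OF A open_box_Rn]) (use m in \<open>force simp: box_Rn_def\<close>)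
  moreover have agree: "\<phi>'' e = \<phi> e" if "e \<in> points T" "q e \<in> ?A'" "q e \<in> ?B" for e
  proof (rule eq[OF that(1,3)])
    have "q e j < m" using that(2) j by (auto simp: box_Rn_def)
    then show "\<rho> (q e) = q e" by (rule \<rho>_id[OF base_points[OF that(1)]])
  qed
  ultimately have "is_trivial_over (\<Union>b\<in>UNIV. if b then ?A' else ?B)"
    using B' by (intro chart_glue[where \<phi> = "\<lambda>b. if b then \<phi> else \<phi>''" and \<psi> = "\<lambda>b. if b then \<psi> else \<psi>''"])
      (simp_all split: if_splits)
  moreover have "box_Rn n (C(j := l')) (D(j := h')) \<subseteq> (\<Union>b\<in>UNIV. if b then ?A' else ?B)"
  proof
    fix x assume x: "x \<in> box_Rn n (C(j := l')) (D(j := h'))"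
    show "x \<in> (\<Union>b\<in>UNIV. if b then ?A' else ?B)"
    proof (cases "x j < m")
      case True
      with x have "x \<in> ?A'" by (auto simp: box_Rn_def)
      then show ?thesis by (intro UN_I[of True]) auto
    next
      case False
      with x m have "x \<in> ?B" by (auto simp: box_Rn_def)
      then show ?thesis by (intro UN_I[of False]) auto
    qed
  qed
  ultimately show ?thesis
    using trivial_over_subset open_box_Rn by blast
qed

text \<open>The family is trivial over an open box that contains the closed box with corners \<open>a\<close> and \<open>b\<close>.
  Closed boxes can be subdivided without overlaps, and the neighbourhoods then overlap.\<close>

definition trivial_near :: "(nat \<Rightarrow> real) \<Rightarrow> (nat \<Rightarrow> real) \<Rightarrow> bool" where
  "trivial_near a b \<longleftrightarrow> (\<exists>c d. (\<forall>i<n. c i < a i \<and> b i < d i) \<and> is_trivial_over (box_Rn n c d))"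

lemma trivial_near_join:
  assumes 1: "trivial_near a (b(j := m))" and 2: "trivial_near (a(j := m)) b"
    and j: "j < n" and le: "\<And>i. i < n \<Longrightarrow> a i \<le> b i" "a j \<le> m" "m \<le> b j"
  shows "trivial_near a b"
proof -
  obtain c d where 1: "\<And>i. i < n \<Longrightarrow> c i < a i \<and> (b(j := m)) i < d i" "is_trivial_over (box_Rn n c d)"
    using 1 by (auto simp: trivial_near_def)
  obtain c' d' where 2: "\<And>i. i < n \<Longrightarrow> c' i < (a(j := m)) i \<and> b i < d' i" 
    "is_trivial_over (box_Rn n c' d')"
    using 2 by (auto simp: trivial_near_def)
  define C where "C i = max (c i) (c' i)" for i
  define D where "D i = min (d i) (d' i)" for i
  have ji: "c j < a j" "m < d j" "c' j < m" "b j < d' j"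
    using 1(1)[OF j] 2(1)[OF j] by auto
  have CD: "C i < a i" "b i < D i" if "i < n" "i \<noteq> j" for i
    using 1(1)[OF that(1)] 2(1)[OF that(1)] that(2) by (auto simp: C_def D_def)
  have A: "is_trivial_over (box_Rn n (C(j := c j)) (D(j := D j)))"
    by (rule trivial_over_subset[OF 1(2) open_box_Rn])
       (auto simp: box_Rn_def C_def D_def split: if_splits)
  have B: "is_trivial_over (box_Rn n (C(j := C j)) (D(j := d' j)))"
    by (rule trivial_over_subset[OF 2(2) open_box_Rn])
       (auto simp: box_Rn_def C_def D_def split: if_splits)
  have "c j \<le> C j" "C j < D j" "D j \<le> d' j"
    using ji le by (auto simp: C_def D_def)
  from trivial_over_join_boxes[OF A B j this]
  show ?thesis
    unfolding trivial_near_def using CD ji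
    by (intro exI[of _ "C(j := c j)"] exI[of _ "D(j := d' j)"]) auto
qed

text \<open>Compactness of the closed box is used one coordinate at a time.  The induction is over the number
  \<open>k\<close> of coordinates in which the box may be nondegenerate.  A box that is degenerate in all
  coordinates is a point, and the step is the bisection principle in direction \<open>k\<close>.\<close>

lemma trivial_near_closed_box:
  assumes local: "\<And>u. u \<in> Rn n \<Longrightarrow> \<exists>U. u \<in> U \<and> is_trivial_over U"
    and "\<And>i. i < n \<Longrightarrow> a i \<le> b i"
  shows "trivial_near a b"
proof -
  have "trivial_near a b"
    if "k \<le> n" "\<And>i. i < n \<Longrightarrow> a i \<le> b i" "\<And>i. k \<le> i \<Longrightarrow> i < n \<Longrightarrow> a i = b i" for k a b
    using that
  proof (induction k arbitrary: a b)
    case 0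
    define u where "u i = (if i < n then a i else 0)" for i
    have "u \<in> Rn n" by (simp add: u_def Rn_iff)
    then obtain U where U: "u \<in> U" "is_trivial_over U" using local by blast
    then have "openin (Euclidean_space n) U" by (auto simp: trivial_over_def intro: chart_open)
    then obtain c d where cd: "\<And>i. c i < u i \<and> u i < d i" "box_Rn n c d \<subseteq> U"
      using box_Rn_nhds U(1) by blast
    have "is_trivial_over (box_Rn n c d)"
      using trivial_over_subset[OF U(2) open_box_Rn cd(2)] .
    moreover have "c i < a i \<and> b i < d i" if "i < n" for i
      using cd(1)[of i] that 0(3)[of i] by (simp add: u_def)
    ultimately show ?case unfolding trivial_near_def by blast
  next
    case (Suc k)
    then have k: "k < n" by simp
    have "a k \<le> b k" using Suc.prems(2) k by blast
    then have "a k \<le> b k \<longrightarrow> trivial_near (a(k := a k)) (b(k := b k))"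
    proof (rule Bolzano[where P = "\<lambda>s t. s \<le> t \<longrightarrow> trivial_near (a(k := s)) (b(k := t))"])
      fix s m t
      assume "s \<le> m \<longrightarrow> trivial_near (a(k := s)) (b(k := m))"
        "m \<le> t \<longrightarrow> trivial_near (a(k := m)) (b(k := t))" "s \<le> m" "m \<le> t"
      then show "s \<le> t \<longrightarrow> trivial_near (a(k := s)) (b(k := t))"
        using Suc.prems(2) k by (intro impI trivial_near_join[of "a(k := s)" "b(k := t)" k m]) auto
    next
      fix s0
      have "trivial_near (a(k := s0)) (b(k := s0))"
        using Suc.prems by (intro Suc.IH) (auto simp: le_less_Suc_eq dest: le_neq_implies_less)
      then obtain c d where cd: "\<And>i. i < n \<Longrightarrow> c i < (a(k := s0)) i \<and> (b(k := s0)) i < d i"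
        "is_trivial_over (box_Rn n c d)"
        by (auto simp: trivial_near_def)
      define \<delta> where "\<delta> = min (s0 - c k) (d k - s0)"
      have "0 < \<delta>" using cd(1)[OF k] by (simp add: \<delta>_def)
      moreover have "trivial_near (a(k := s)) (b(k := t))" if "s \<le> s0" "s0 \<le> t" "t - s < \<delta>" for s t
      proof -
        have "c i < (a(k := s)) i \<and> (b(k := t)) i < d i" if "i < n" for i
          using cd(1)[OF that] \<open>s \<le> s0\<close> \<open>s0 \<le> t\<close> \<open>t - s < \<delta>\<close> by (auto simp: \<delta>_def)
        with cd(2) show ?thesis unfolding trivial_near_def by blast
      qed
      ultimately show "\<exists>\<delta>>0. \<forall>s t. s \<le> s0 \<and> s0 \<le> t \<and> t - s < \<delta> \<longrightarrow> s \<le> t \<longrightarrow>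
          trivial_near (a(k := s)) (b(k := t))"
        by blast
    qed
    with \<open>a k \<le> b k\<close> show ?case by simp
  qed
  from this[of n a b] assms(2) show ?thesis by simp
qed

text \<open>The open cube with centre the origin and half side \<open>s\<close>.\<close>

abbreviation cube :: "real \<Rightarrow> (nat \<Rightarrow> real) set" where
  "cube s \<equiv> box_Rn n (\<lambda>i. - s) (\<lambda>i. s)"

text \<open>A trivialisation over the cube of half side \<open>k + 1\<close> is changed into one over the cube of half side
  \<open>k + 2\<close>, without any change over the cube of half side \<open>k\<close>.  The resulting sequence is therefore
  stationary over every cube, and its limit is a trivialisation over $R^n$.\<close>

lemma trivial_over_Rn:
  assumes local: "\<And>u. u \<in> Rn n \<Longrightarrow> \<exists>U. u \<in> U \<and> is_trivial_over U"
  shows "is_trivial_over (Rn n)"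
proof -
  have cube: "is_trivial_over (cube s)" if "0 \<le> s" for s
  proof -
    have "trivial_near (\<lambda>i. - s) (\<lambda>i. s)"
      by (rule trivial_near_closed_box[OF local]) (use that in auto)
    then obtain c d where cd: "\<And>i. i < n \<Longrightarrow> c i < - s \<and> s < d i" "is_trivial_over (box_Rn n c d)"
      by (auto simp: trivial_near_def)
    show ?thesis
      by (rule trivial_over_subset[OF cd(2) open_box_Rn]) (use cd(1) in \<open>force simp: box_Rn_def\<close>)
  qed
  have extend: "\<exists>\<phi>' \<psi>'. is_chart (cube (real k + 2)) \<phi>' \<psi>' \<and>
      (\<forall>e\<in>points T. q e \<in> cube (real k) \<longrightarrow> \<phi>' e = \<phi> e)"
    if \<phi>: "is_chart (cube (real k + 1)) \<phi> \<psi>" for k \<phi> \<psi>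
  proof -
    obtain \<phi>1 \<psi>1 where \<phi>1: "is_chart (cube (real k + 2)) \<phi>1 \<psi>1"
      using cube[of "real k + 2"] by (auto simp: trivial_over_def)
    obtain r where r: "smooth_fun r" "\<And>t. \<bar>t\<bar> \<le> real k \<Longrightarrow> r t = t" "\<And>t. \<bar>r t\<bar> < real k + 1"
      using smooth_cutoff[of "real k" "real k + 1"] by auto
    define \<rho> where "\<rho> x = (\<lambda>i. if i < n then r (x i) else 0)" for x :: "nat \<Rightarrow> real"
    have "smooth_map (sub_diff (Eucl n) (cube (real k + 2))) (Eucl n) \<rho>"
      unfolding \<rho>_def by (rule smooth_map_coordinatewise) (rule r(1))
    moreover have "\<rho> u \<in> cube (real k + 1) \<inter> cube (real k + 2)" for u
    proof -
      have "- (real k + 1) < r t" "r t < real k + 1" "- (real k + 2) < r t" "r t < real k + 2" for t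
        using r(3)[of t] by (auto simp: abs_less_iff)
      then show ?thesis by (simp add: box_Rn_def \<rho>_def Rn_iff)
    qed
    ultimately obtain \<phi>' \<psi>' where *: "is_chart (cube (real k + 2)) \<phi>' \<psi>'"
      "\<And>e. e \<in> points T \<Longrightarrow> q e \<in> cube (real k + 2) \<Longrightarrow> \<rho> (q e) = q e \<Longrightarrow> \<phi>' e = \<phi> e"
      using chart_modify[OF \<phi> \<phi>1] by blast
    have "\<phi>' e = \<phi> e" if "e \<in> points T" "q e \<in> cube (real k)" for e
    proof (rule *(2)[OF that(1)])
      show "q e \<in> cube (real k + 2)" using that(2) by (force simp: box_Rn_def)
      have "r (q e i) = q e i" if "i < n" for i
        using r(2)[of "q e i"] \<open>q e \<in> cube (real k)\<close> that by (force simp: box_Rn_def)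
      then show "\<rho> (q e) = q e"
        using that(2) by (auto simp: \<rho>_def fun_eq_iff box_Rn_def Rn_iff)
    qed
    with *(1) show ?thesis by blast
  qed
  obtain \<phi>\<psi> where charts: "\<And>k. is_chart (cube (real k + 1)) (fst (\<phi>\<psi> k)) (snd (\<phi>\<psi> k))"
    and step: "\<And>k e. e \<in> points T \<Longrightarrow> q e \<in> cube (real k) \<Longrightarrow> fst (\<phi>\<psi> (Suc k)) e = fst (\<phi>\<psi> k) e"
  proof -
    have "\<exists>f. \<forall>k. is_chart (cube (real k + 1)) (fst (f k)) (snd (f k)) \<and>
      (\<forall>e\<in>points T. q e \<in> cube (real k) \<longrightarrow> fst (f (Suc k)) e = fst (f k) e)"
    proof (rule dependent_nat_choice)
      show "\<exists>x. is_chart (cube (real 0 + 1)) (fst x) (snd x)"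
        using cube[of 1] by (auto simp: trivial_over_def)
      show "\<exists>y. is_chart (cube (real (Suc k) + 1)) (fst y) (snd y) \<and>
        (\<forall>e\<in>points T. q e \<in> cube (real k) \<longrightarrow> fst y e = fst x e)"
        if "is_chart (cube (real k + 1)) (fst x) (snd x)" for x k
        using extend[OF that] by (simp add: add.commute)
    qed
    with that show thesis by blast
  qed
  have stable: "fst (\<phi>\<psi> (k + l)) e = fst (\<phi>\<psi> k) e" if "e \<in> points T" "q e \<in> cube (real k)" for k l e
  proof (induction l)
    case (Suc l)
    have "q e \<in> cube (real (k + l))" using that(2) by (force simp: box_Rn_def)
    with step[OF that(1)] Suc show ?case by simp
  qed simp
  have "is_trivial_over (\<Union>k\<in>UNIV. cube (real k))"
  proof (rule chart_glue)
    show "is_chart (cube (real k)) (fst (\<phi>\<psi> k)) (snd (\<phi>\<psi> k))" for k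
      by (rule chart_restrict[OF charts open_box_Rn]) (force simp: box_Rn_def)
    show "fst (\<phi>\<psi> i) e = fst (\<phi>\<psi> j) e"
      if "e \<in> points T" "q e \<in> cube (real i)" "q e \<in> cube (real j)" for i j e
      using stable[OF that(1,2), of "j - i"] stable[OF that(1,3), of "i - j"]
      by (cases "i \<le> j") auto
  qed
  moreover have "(\<Union>k\<in>UNIV. cube (real k)) = Rn n"
  proof
    show "Rn n \<subseteq> (\<Union>k\<in>UNIV. cube (real k))"
    proof
      fix x assume x: "x \<in> Rn n"
      obtain k where k: "(\<Sum>i<n. \<bar>x i\<bar>) < real k" using reals_Archimedean2 by blast
      have "- real k < x i \<and> x i < real k" if "i < n" for i
        using member_le_sum[of i "{..<n}" "\<lambda>i. \<bar>x i\<bar>"] that k by (auto simp: abs_less_iff)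
      with x show "x \<in> (\<Union>k\<in>UNIV. cube (real k))" by (auto simp: box_Rn_def)
    qed
  qed (auto simp: box_Rn_def)
  ultimately show ?thesis by simp
qed

end

lemma trivial_bundle_imp_trivial_over:
  assumes U: "openin (Euclidean_space n) U"
    and triv: "trivial_bundle F (sub_diff T (q -` U)) (sub_diff (Eucl n) U) q"
  shows "trivial_over n F T q U"
proof -
  let ?S = "sub_diff T (q -` U)" and ?P = "prod_diff F (sub_diff (Eucl n) U)"
  obtain h k where h: "smooth_map ?S ?P h" and k: "smooth_map ?P ?S k"
    and kh: "\<And>x. x \<in> points ?S \<Longrightarrow> k (h x) = x" and hk: "\<And>y. y \<in> points ?P \<Longrightarrow> h (k y) = y"
    and snd_h: "\<And>x. x \<in> points ?S \<Longrightarrow> snd (h x) = q x"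
    using triv by (auto simp: trivial_bundle_def diffeomorphism_def)
  have "chart n F T q U (\<lambda>e. fst (h e)) k"
    unfolding chart_def
  proof (intro conjI ballI impI)
    show "smooth_map ?S F (\<lambda>e. fst (h e))"
      using h smooth_map_fst by (rule smooth_map_compose)
    show "smooth_map ?P T k" using k by (rule smooth_map_of_sub)
  next
    fix v u assume "v \<in> points F" "u \<in> U"
    then have y: "(v, u) \<in> points ?P" using openin_Euclidean_subset[OF U] by auto
    show "fst (h (k (v, u))) = v" using hk[OF y] by simp
    show "q (k (v, u)) = u" using snd_h[OF smooth_map_points[OF k y]] hk[OF y] by simp
  next
    fix e assume "e \<in> points T" "q e \<in> U"
    then have e: "e \<in> points ?S" by simp
    show "k (fst (h e), q e) = e" using kh[OF e] by (simp flip: snd_h[OF e])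
  qed (rule U)
  then show ?thesis by (auto simp: trivial_over_def)
qed

lemma D_open_Eucl:
  assumes "openin (D_topology (Eucl n)) U"
  shows "openin (Euclidean_space n) U"
proof -
  have U: "U \<subseteq> Rn n" using assms by (simp add: openin_D_topology)
  have "openin (Euclidean_space n) {u \<in> Rn n. restrict (\<lambda>x. x) (Rn n) u \<in> U}"
    using assms id_plot_Eucl unfolding openin_D_topology by blast
  moreover have "{u \<in> Rn n. restrict (\<lambda>x. x) (Rn n) u \<in> U} = U" using U by auto
  ultimately show ?thesis by simp
qed

theorem locally_trivial_over_Rn_trivial:
  assumes "plot_sheaf F" and "plot_sheaf T" and "locally_trivial_bundle F T (Eucl n) q"
  shows "trivial_over n F T q (Rn n)"
proof -
  obtain \<U> where q: "smooth_map T (Eucl n) q" and \<U>: "\<Union>\<U> = Rn n"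
    "\<And>U. U \<in> \<U> \<Longrightarrow> openin (D_topology (Eucl n)) U"
    "\<And>U. U \<in> \<U> \<Longrightarrow> trivial_bundle F (sub_diff T (q -` U)) (sub_diff (Eucl n) U) q"
    using assms(3) by (auto simp: locally_trivial_bundle_def)
  interpret Euclidean_family n F T q
    using assms(1,2) q by (rule Euclidean_family.intro)
  show ?thesis
  proof (rule trivial_over_Rn)
    fix u assume "u \<in> Rn n"
    then obtain U where U: "U \<in> \<U>" "u \<in> U" using \<U>(1) by blast
    have "is_trivial_over U"
      using D_open_Eucl[OF \<U>(2)[OF U(1)]] \<U>(3)[OF U(1)] by (rule trivial_bundle_imp_trivial_over)
    with U(2) show "\<exists>U. u \<in> U \<and> is_trivial_over U" by blast
  qed
qed

section \<open>The smooth singular simplicial set\<close>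

lemma points_affine_simplex: "points (affine_simplex m) = {x \<in> Rn (Suc m). (\<Sum>i\<le>m. x i) = 1}"
  by (auto simp: affine_simplex_def)

lemma plot_sheaf_affine_simplex: "plot_sheaf (affine_simplex m)"
  unfolding affine_simplex_def by (intro plot_sheaf_sub plot_sheaf_Eucl)

lemma affine_map_sum:
  assumes "\<theta> \<in> Delta m n"
  shows "(\<Sum>j\<le>n. affine_map m \<theta> x j) = (\<Sum>i\<le>m. x i)"
proof -
  have "(\<Sum>j\<le>n. \<Sum>i\<in>{i \<in> {..m}. \<theta> i = j}. x i) = (\<Sum>i\<le>m. x i)"
    using assms by (intro sum.group) (auto simp: Delta_def)
  then show ?thesis by (simp add: affine_map_def)
qed

lemma smooth_affine_map:
  assumes \<theta>: "\<theta> \<in> Delta m n"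
  shows "smooth_map (affine_simplex m) (affine_simplex n) (affine_map m \<theta>)"
  unfolding affine_simplex_def[of n]
proof (intro smooth_map_into_sub smooth_map_EuclI plot_sheaf_affine_simplex)
  show "affine_map m \<theta> x \<in> Rn (Suc n)" for x
  proof -
    have "{i. i \<le> m \<and> \<theta> i = j} = {}" if "Suc n \<le> j" for j
      using \<theta> that by (auto simp: Delta_def PiE_def Pi_def)
    then show ?thesis by (auto simp: Rn_iff affine_map_def intro!: sum.neutral)
  qed
  show "Ck_on k l U (\<lambda>u. affine_map m \<theta> (p u) j)"
    if "p \<in> plots (affine_simplex m) l U" "openin (Euclidean_space l) U" for l U p j k
    unfolding affine_map_def
    by (intro Ck_on_sum) (use that in \<open>auto simp: affine_simplex_def plots_Eucl\<close>)
  show "affine_map m \<theta> x \<in> {x. (\<Sum>i\<le>n. x i) = 1}" if "x \<in> points (affine_simplex m)" for x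
    using that by (simp add: affine_map_sum[OF \<theta>] points_affine_simplex)
qed

lemma affine_map_points:
  "\<theta> \<in> Delta m n \<Longrightarrow> x \<in> points (affine_simplex m) \<Longrightarrow> affine_map m \<theta> x \<in> points (affine_simplex n)"
  by (rule smooth_map_points[OF smooth_affine_map])

lemma affine_map_compose:
  assumes "\<eta> \<in> Delta l m"
  shows "affine_map l (compose {..l} \<theta> \<eta>) x = affine_map m \<theta> (affine_map l \<eta> x)"
proof
  fix j
  have "(\<Sum>k\<in>{k \<in> {..m}. \<theta> k = j}. \<Sum>i\<in>{i \<in> {i \<in> {..l}. \<theta> (\<eta> i) = j}. \<eta> i = k}. x i)
      = (\<Sum>i\<in>{i \<in> {..l}. \<theta> (\<eta> i) = j}. x i)"
    using assms by (intro sum.group) (auto simp: Delta_def)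
  moreover have "{i \<in> {i \<in> {..l}. \<theta> (\<eta> i) = j}. \<eta> i = k} = {i. i \<le> l \<and> \<eta> i = k}"
    if "\<theta> k = j" for k using that by auto
  moreover have "{i. i \<le> l \<and> compose {..l} \<theta> \<eta> i = j} = {i \<in> {..l}. \<theta> (\<eta> i) = j}"
    by (auto simp: compose_def)
  ultimately show "affine_map l (compose {..l} \<theta> \<eta>) x j = affine_map m \<theta> (affine_map l \<eta> x) j"
    by (simp add: affine_map_def)
qed

lemma affine_map_id:
  assumes "x \<in> points (affine_simplex n)"
  shows "affine_map n (\<lambda>i\<in>{..n}. i) x = x"
proof
  fix j
  have "{i. i \<le> n \<and> (\<lambda>i\<in>{..n}. i) i = j} = (if j \<le> n then {j} else {})" by auto
  with assms show "affine_map n (\<lambda>i\<in>{..n}. i) x j = x j"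
    by (auto simp: affine_map_def points_affine_simplex Rn_iff)
qed

lemma CinfI:
  assumes "plot_sheaf A" and "smooth_map A X f"
  shows "(\<lambda>x\<in>points A. f x) \<in> Cinf A X"
  using smooth_map_cong[OF assms, of "\<lambda>x\<in>points A. f x"] by (simp add: Cinf_def)

lemma Cinf_smooth: "f \<in> Cinf A X \<Longrightarrow> smooth_map A X f"
  by (simp add: Cinf_def)

lemma Cinf_ext: "f \<in> Cinf A X \<Longrightarrow> f \<in> extensional (points A)"
  by (simp add: Cinf_def)

lemma simplices_SD [simp]: "simplices (SD X) n = Cinf (affine_simplex n) X"
  by (simp add: SD_def)

lemma act_SD: "act (SD X) m n \<theta> \<sigma> = (\<lambda>x\<in>points (affine_simplex m). \<sigma> (affine_map m \<theta> x))"
  by (simp add: SD_def compose_def)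

lemma simplicial_set_SD: "simplicial_set (SD X)"
proof
  show "act (SD X) m n \<theta> s \<in> simplices (SD X) m"
    if "\<theta> \<in> Delta m n" "s \<in> simplices (SD X) n" for \<theta> m n s
    using that smooth_map_compose[OF smooth_affine_map[OF that(1)] Cinf_smooth]
    by (auto simp: act_SD intro!: CinfI plot_sheaf_affine_simplex)
  show "act (SD X) n n (\<lambda>i\<in>{..n}. i) s = s" if "s \<in> simplices (SD X) n" for n s
    unfolding act_SD
  proof (rule extensionalityI[where A = "points (affine_simplex n)"])
    show "s \<in> extensional (points (affine_simplex n))" using that Cinf_ext by simp
  qed (auto simp: affine_map_id)
  show "act (SD X) l n (compose {..l} \<theta> \<eta>) s = act (SD X) l m \<eta> (act (SD X) m n \<theta> s)"
    if "\<eta> \<in> Delta l m" for \<theta> m n \<eta> l s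
    using that by (auto simp: act_SD affine_map_compose affine_map_points)
qed

lemma simplicial_map_SD_map:
  assumes "smooth_map X Y f"
  shows "simplicial_map (SD X) (SD Y) (SD_map f)"
  unfolding simplicial_map_def
proof (intro conjI allI ballI)
  show "SD_map f n \<in> simplices (SD X) n \<rightarrow> simplices (SD Y) n" for n
    using smooth_map_compose[OF Cinf_smooth assms]
    by (auto simp: SD_map_def compose_def intro!: CinfI plot_sheaf_affine_simplex)
  show "SD_map f m (act (SD X) m n \<theta> s) = act (SD Y) m n \<theta> (SD_map f n s)"
    if "\<theta> \<in> Delta m n" for m n \<theta> s
    using that by (auto simp: SD_map_def act_SD compose_def affine_map_points)
qed

section \<open>Lifting horns\<close>

text \<open>A smooth retraction of $R^{n+1}$ onto the affine simplex: the last coordinate is replaced by the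
  value that makes the sum equal to one.  Composing a simplex of \<open>Y\<close> with it gives a plot of \<open>Y\<close>
  defined on a whole Euclidean space.\<close>

definition affine_retract :: "nat \<Rightarrow> (nat \<Rightarrow> real) \<Rightarrow> nat \<Rightarrow> real" where
  "affine_retract n x = x(n := 1 - (\<Sum>i<n. x i))"

lemma smooth_affine_retract: "smooth_map (Eucl (Suc n)) (affine_simplex n) (affine_retract n)"
  unfolding affine_simplex_def
proof (intro smooth_map_into_sub smooth_map_EuclI plot_sheaf_Eucl)
  show "affine_retract n x \<in> Rn (Suc n)" if "x \<in> points (Eucl (Suc n))" for x
    using that by (simp add: affine_retract_def Rn_iff)
  have "(\<Sum>i<n. (x(n := c)) i) = (\<Sum>i<n. x i)" for x :: "nat \<Rightarrow> real" and c
    by (intro sum.cong) auto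
  then show "affine_retract n x \<in> {x. (\<Sum>i\<le>n. x i) = 1}" for x
    by (simp add: affine_retract_def lessThan_Suc_atMost[symmetric])
  show "Ck_on k l U (\<lambda>u. affine_retract n (p u) j)"
    if p: "p \<in> plots (Eucl (Suc n)) l U" and U: "openin (Euclidean_space l) U" and j: "j < Suc n"
    for l U p j k
  proof (cases "j = n")
    case True
    have "Ck_on k l U (\<lambda>u. 1 + (- 1) * (\<Sum>i<n. p u i))"
      using p by (intro Ck_on_add Ck_on_mult Ck_on_sum Ck_on_const U) (auto simp: plots_Eucl)
    with True show ?thesis by (simp add: affine_retract_def)
  next
    case False
    with p j show ?thesis by (simp add: affine_retract_def plots_Eucl)
  qed
qed

lemma affine_retract_id: "x \<in> points (affine_simplex n) \<Longrightarrow> affine_retract n x = x"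
  by (auto simp: points_affine_simplex affine_retract_def fun_eq_iff lessThan_Suc_atMost[symmetric])

text \<open>The family \<open>T\<close> is the pullback of \<open>f\<close> along the plot \<open>p\<close>, an extension of the simplex \<open>\<sigma>\<close> of \<open>Y\<close> that
  is to be lifted.  A global trivialisation turns the horn \<open>\<alpha>\<close> of \<open>X\<close> into a horn \<open>\<alpha>'\<close> of \<open>F\<close>, and a
  filler \<open>\<gamma>'\<close> of the latter into a filler \<open>\<gamma>\<close> of \<open>\<alpha>\<close> over \<open>\<sigma>\<close>.\<close>

lemma Kan_fibration_SD_lift:
  assumes X: "plot_sheaf X" and fib: "diffeological_bundle F X Y f"
    and F: "plot_sheaf F" "Kan_complex (SD F)"
    and n: "1 \<le> n" "k \<le> n"
    and \<alpha>: "simplicial_map (horn n k) (SD X) \<alpha>" and \<beta>: "simplicial_map (std_simplex n) (SD Y) \<beta>"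
    and square: "\<And>m \<theta>. \<theta> \<in> simplices (horn n k) m \<Longrightarrow> SD_map f m (\<alpha> m \<theta>) = \<beta> m \<theta>"
  shows "\<exists>\<gamma>. simplicial_map (std_simplex n) (SD X) \<gamma> \<and>
    (\<forall>m. \<forall>\<theta>\<in>simplices (horn n k) m. \<gamma> m \<theta> = \<alpha> m \<theta>) \<and>
    (\<forall>m. \<forall>\<theta>\<in>simplices (std_simplex n) m. SD_map f m (\<gamma> m \<theta>) = \<beta> m \<theta>)"
proof -
  let ?A = affine_simplex
  have id: "(\<lambda>i\<in>{..n}. i) \<in> Delta n n"
    by (auto simp: Delta_def mono_on_def)
  \<comment> \<open>A map out of the standard simplex is determined by the image \<open>\<sigma>\<close> of the identity.\<close>
  define \<sigma> where "\<sigma> = \<beta> n (\<lambda>i\<in>{..n}. i)"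
  have \<sigma>: "smooth_map (?A n) Y \<sigma>"
    using \<beta> id by (auto simp: \<sigma>_def simplicial_map_def std_simplex_def intro: Cinf_smooth)
  have \<beta>_eq: "\<beta> m \<theta> = (\<lambda>x\<in>points (?A m). \<sigma> (affine_map m \<theta> x))" if \<theta>: "\<theta> \<in> Delta m n" for m \<theta>
  proof -
    have "compose {..m} (\<lambda>i\<in>{..n}. i) \<theta> = \<theta>"
    proof (rule extensionalityI[where A = "{..m}"])
      fix i assume "i \<in> {..m}"
      moreover from this \<theta> have "\<theta> i \<le> n" by (auto simp: Delta_def)
      ultimately show "compose {..m} (\<lambda>i\<in>{..n}. i) \<theta> i = \<theta> i" by (simp add: compose_def)
    qed (use \<theta> in \<open>auto simp: Delta_def PiE_def\<close>)
    moreover have "\<beta> m (compose {..m} (\<lambda>i\<in>{..n}. i) \<theta>) = act (SD Y) m n \<theta> (\<beta> n (\<lambda>i\<in>{..n}. i))"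
      using \<beta> \<theta> id by (simp add: simplicial_map_def std_simplex_def)
    ultimately show ?thesis by (simp add: \<sigma>_def act_SD)
  qed
  define E where "E = Eucl (Suc n)"
  define p where "p = (\<lambda>u\<in>Rn (Suc n). \<sigma> (affine_retract n u))"
  have "smooth_map E Y (\<lambda>u. \<sigma> (affine_retract n u))"
    unfolding E_def by (rule smooth_map_compose[OF smooth_affine_retract \<sigma>])
  moreover have "restrict (\<lambda>x. x) (Rn (Suc n)) \<in> plots E (Suc n) (Rn (Suc n))"
    unfolding E_def by (rule id_plot_Eucl)
  ultimately have "compose (Rn (Suc n)) (\<lambda>u. \<sigma> (affine_retract n u)) (restrict (\<lambda>x. x) (Rn (Suc n)))
      \<in> plots Y (Suc n) (Rn (Suc n))"
    unfolding smooth_map_def by blast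
  moreover have "compose (Rn (Suc n)) (\<lambda>u. \<sigma> (affine_retract n u)) (restrict (\<lambda>x. x) (Rn (Suc n))) = p"
    by (auto simp: compose_def p_def restrict_def)
  ultimately have p_plot: "p \<in> plots Y (Suc n) (Rn (Suc n))" by simp
  define T where "T = pullback_diff E X p f"
  have T: "plot_sheaf T"
    unfolding T_def pullback_diff_def E_def by (intro plot_sheaf_sub plot_sheaf_prod plot_sheaf_Eucl X)
  have "locally_trivial_bundle F (pullback_diff (sub_diff (Eucl (Suc n)) (Rn (Suc n))) X p f)
      (sub_diff (Eucl (Suc n)) (Rn (Suc n))) fst"
    using fib p_plot unfolding diffeological_bundle_def by blast
  then have "locally_trivial_bundle F T (Eucl (Suc n)) fst"
    unfolding sub_diff_Eucl_Rn T_def E_def .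
  from locally_trivial_over_Rn_trivial[OF F(1) T this] obtain \<phi> \<psi>
    where chart: "chart (Suc n) F T fst (Rn (Suc n)) \<phi> \<psi>"
    by (auto simp: trivial_over_def)
  note ch = chartD[OF chart]
  have pT: "points T = {(u, x). u \<in> Rn (Suc n) \<and> x \<in> points X \<and> p u = f x}"
    by (auto simp: T_def pullback_diff_def E_def)
  have T_sub: "sub_diff T (fst -` Rn (Suc n)) = T"
    by (rule sub_diff_superset[OF T]) (auto simp: pT)
  have \<phi>: "smooth_map T F \<phi>" using ch(3) by (simp add: T_sub)
  have \<psi>: "smooth_map (prod_diff F E) T \<psi>" using ch(4) by (simp add: sub_diff_Eucl_Rn E_def)
  have A_E: "smooth_map (?A m) E (affine_map m \<theta>)" if "\<theta> \<in> Delta m n" for m \<theta>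
    using smooth_affine_map[OF that] unfolding affine_simplex_def[of n] E_def by (rule smooth_map_of_sub)
  have A_Rn: "affine_map m \<theta> x \<in> Rn (Suc n)"
    and p_A: "p (affine_map m \<theta> x) = \<sigma> (affine_map m \<theta> x)"
    if "\<theta> \<in> Delta m n" "x \<in> points (?A m)" for m \<theta> x
  proof -
    have *: "affine_map m \<theta> x \<in> points (?A n)" by (rule affine_map_points[OF that])
    then show 1: "affine_map m \<theta> x \<in> Rn (Suc n)" by (simp add: points_affine_simplex)
    show "p (affine_map m \<theta> x) = \<sigma> (affine_map m \<theta> x)"
      using 1 affine_retract_id[OF *] by (simp add: p_def)
  qed
  have horn_Delta: "\<theta> \<in> Delta m n" if "\<theta> \<in> simplices (horn n k) m" for \<theta> m
    using that by (simp add: horn_def)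
  have \<alpha>_smooth: "smooth_map (?A m) X (\<alpha> m \<theta>)" and \<alpha>_ext: "\<alpha> m \<theta> \<in> extensional (points (?A m))"
    if "\<theta> \<in> simplices (horn n k) m" for m \<theta>
    using \<alpha> that by (auto simp: simplicial_map_def Cinf_def Pi_def)
  have f_\<alpha>: "f (\<alpha> m \<theta> x) = \<sigma> (affine_map m \<theta> x)"
    if "\<theta> \<in> simplices (horn n k) m" "x \<in> points (?A m)" for m \<theta> x
  proof -
    have "SD_map f m (\<alpha> m \<theta>) x = \<beta> m \<theta> x" using square[OF that(1)] by simp
    then show ?thesis
      using that by (simp add: SD_map_def compose_def \<beta>_eq[OF horn_Delta])
  qed
  have graph: "(affine_map m \<theta> x, \<alpha> m \<theta> x) \<in> points T"
    if "\<theta> \<in> simplices (horn n k) m" "x \<in> points (?A m)" for m \<theta> x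
    using smooth_map_points[OF \<alpha>_smooth] f_\<alpha> p_A A_Rn horn_Delta that by (simp add: pT)
  define \<alpha>' where "\<alpha>' m \<theta> = (\<lambda>x\<in>points (?A m). \<phi> (affine_map m \<theta> x, \<alpha> m \<theta> x))" for m \<theta>
  have "simplicial_map (horn n k) (SD F) \<alpha>'"
    unfolding simplicial_map_def
  proof (intro conjI allI ballI funcsetI)
    fix m \<theta> assume \<theta>: "\<theta> \<in> simplices (horn n k) m"
    have "smooth_map (?A m) (prod_diff E X) (\<lambda>x. (affine_map m \<theta> x, \<alpha> m \<theta> x))"
      by (intro smooth_map_Pair plot_sheaf_affine_simplex A_E \<alpha>_smooth horn_Delta \<theta>)
    then have "smooth_map (?A m) T (\<lambda>x. (affine_map m \<theta> x, \<alpha> m \<theta> x))"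
      unfolding T_def pullback_diff_def
      by (rule smooth_map_into_sub[OF plot_sheaf_affine_simplex]) (use graph[OF \<theta>] in \<open>simp add: pT\<close>)
    from smooth_map_compose[OF this \<phi>]
    show "\<alpha>' m \<theta> \<in> simplices (SD F) m"
      unfolding \<alpha>'_def simplices_SD by (intro CinfI plot_sheaf_affine_simplex)
  next
    fix l m \<eta> \<theta> assume \<eta>: "\<eta> \<in> Delta l m" and \<theta>: "\<theta> \<in> simplices (horn n k) m"
    have act: "act (horn n k) l m \<eta> \<theta> = compose {..l} \<theta> \<eta>" by (simp add: horn_def)
    have "\<alpha> l (compose {..l} \<theta> \<eta>) = act (SD X) l m \<eta> (\<alpha> m \<theta>)"
      using \<alpha> \<eta> \<theta> by (simp add: simplicial_map_def flip: act)
    then show "\<alpha>' l (act (horn n k) l m \<eta> \<theta>) = act (SD F) l m \<eta> (\<alpha>' m \<theta>)"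
      using \<eta> by (auto simp: act \<alpha>'_def act_SD affine_map_points affine_map_compose fun_eq_iff)
  qed
  then obtain \<gamma>' where \<gamma>': "simplicial_map (std_simplex n) (SD F) \<gamma>'"
    and \<gamma>'_horn: "\<And>m \<theta>. \<theta> \<in> simplices (horn n k) m \<Longrightarrow> \<gamma>' m \<theta> = \<alpha>' m \<theta>"
    using F(2) n unfolding Kan_complex_def by blast
  have \<gamma>'_smooth: "smooth_map (?A m) F (\<gamma>' m \<theta>)" if "\<theta> \<in> Delta m n" for m \<theta>
    using \<gamma>' that by (auto simp: simplicial_map_def std_simplex_def Pi_def intro: Cinf_smooth)
  define \<gamma> where "\<gamma> m \<theta> = (\<lambda>x\<in>points (?A m). snd (\<psi> (\<gamma>' m \<theta> x, affine_map m \<theta> x)))" for m \<theta>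
  have "simplicial_map (std_simplex n) (SD X) \<gamma>"
    unfolding simplicial_map_def
  proof (intro conjI allI ballI funcsetI)
    fix m \<theta> assume "\<theta> \<in> simplices (std_simplex n) m"
    then have \<theta>: "\<theta> \<in> Delta m n" by (simp add: std_simplex_def)
    have "smooth_map T X snd"
      unfolding T_def pullback_diff_def by (intro smooth_map_from_sub smooth_map_snd)
    moreover have "smooth_map (?A m) (prod_diff F E) (\<lambda>x. (\<gamma>' m \<theta> x, affine_map m \<theta> x))"
      by (intro smooth_map_Pair plot_sheaf_affine_simplex \<gamma>'_smooth A_E \<theta>)
    ultimately have "smooth_map (?A m) X (\<lambda>x. snd (\<psi> (\<gamma>' m \<theta> x, affine_map m \<theta> x)))"
      by (intro smooth_map_compose[OF smooth_map_compose[OF _ \<psi>]])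
    then show "\<gamma> m \<theta> \<in> simplices (SD X) m"
      unfolding \<gamma>_def simplices_SD by (intro CinfI plot_sheaf_affine_simplex)
  next
    fix l m \<eta> \<theta> assume \<eta>: "\<eta> \<in> Delta l m" and \<theta>: "\<theta> \<in> simplices (std_simplex n) m"
    have act: "act (std_simplex n) l m \<eta> \<theta> = compose {..l} \<theta> \<eta>" by (simp add: std_simplex_def)
    have "\<gamma>' l (compose {..l} \<theta> \<eta>) = act (SD F) l m \<eta> (\<gamma>' m \<theta>)"
      using \<gamma>' \<eta> \<theta> by (simp add: simplicial_map_def flip: act)
    then show "\<gamma> l (act (std_simplex n) l m \<eta> \<theta>) = act (SD X) l m \<eta> (\<gamma> m \<theta>)"
      using \<eta> by (auto simp: act \<gamma>_def act_SD affine_map_points affine_map_compose fun_eq_iff)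
  qed
  moreover have "\<gamma> m \<theta> = \<alpha> m \<theta>" if \<theta>: "\<theta> \<in> simplices (horn n k) m" for m \<theta>
  proof (rule extensionalityI[where A = "points (?A m)"])
    fix x assume x: "x \<in> points (?A m)"
    show "\<gamma> m \<theta> x = \<alpha> m \<theta> x"
      using ch(9)[OF graph[OF \<theta> x]] A_Rn[OF horn_Delta[OF \<theta>] x] x
      by (simp add: \<gamma>_def \<gamma>'_horn[OF \<theta>] \<alpha>'_def)
  qed (auto simp: \<gamma>_def \<alpha>_ext[OF \<theta>])
  moreover have "SD_map f m (\<gamma> m \<theta>) = \<beta> m \<theta>" if "\<theta> \<in> simplices (std_simplex n) m" for m \<theta>
  proof -
    have \<theta>: "\<theta> \<in> Delta m n" using that by (simp add: std_simplex_def)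
    have "f (\<gamma> m \<theta> x) = \<sigma> (affine_map m \<theta> x)" if x: "x \<in> points (?A m)" for x
    proof -
      let ?e = "\<psi> (\<gamma>' m \<theta> x, affine_map m \<theta> x)"
      have v: "\<gamma>' m \<theta> x \<in> points F" by (rule smooth_map_points[OF \<gamma>'_smooth[OF \<theta>] x])
      have "?e \<in> points T" "fst ?e = affine_map m \<theta> x"
        using v A_Rn[OF \<theta> x] by (simp_all add: ch(6,7))
      then have "f (snd ?e) = p (affine_map m \<theta> x)" by (auto simp: pT)
      with p_A[OF \<theta> x] x show ?thesis by (simp add: \<gamma>_def)
    qed
    then show ?thesis by (auto simp: SD_map_def compose_def \<beta>_eq[OF \<theta>])
  qed
  ultimately show ?thesis by blast
qed

theorem proposition4p28:
  fixes X :: "'a diffspace" and Y :: "'b diffspace" and F :: "'c diffspace"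
    and f :: "'a \<Rightarrow> 'b"
  assumes "diffeological_space X" and "diffeological_space Y" and "diffeological_space F"
    and "diffeological_bundle F X Y f"
    and "fibrant F"
  shows "diff_fibration X Y f"
proof -
  have f: "smooth_map X Y f" using assms(4) by (simp add: diffeological_bundle_def)
  have sheaf: "plot_sheaf X" "plot_sheaf F"
    using assms(1,3) by (auto intro: diffeological_space.plot_sheaf)
  have Kan: "Kan_complex (SD F)" using assms(5) by (simp add: fibrant_def)
  show ?thesis
    unfolding diff_fibration_def Kan_fibration_def
  proof (intro conjI allI impI f simplicial_set_SD simplicial_map_SD_map)
    fix n k \<alpha> \<beta>
    assume n: "1 \<le> n" "k \<le> n"
      and "simplicial_map (horn n k) (SD X) \<alpha> \<and> simplicial_map (std_simplex n) (SD Y) \<beta> \<and>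
        (\<forall>m. \<forall>\<theta>\<in>simplices (horn n k) m. SD_map f m (\<alpha> m \<theta>) = \<beta> m \<theta>)"
    then show "\<exists>\<gamma>. simplicial_map (std_simplex n) (SD X) \<gamma> \<and>
        (\<forall>m. \<forall>\<theta>\<in>simplices (horn n k) m. \<gamma> m \<theta> = \<alpha> m \<theta>) \<and>
        (\<forall>m. \<forall>\<theta>\<in>simplices (std_simplex n) m. SD_map f m (\<gamma> m \<theta>) = \<beta> m \<theta>)"
      by (intro Kan_fibration_SD_lift[OF sheaf(1) assms(4) sheaf(2) Kan n]) auto
  qed
qed

end
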